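(* Suppose there exists a finite $t>1$ such that $\mathrm{supp}(\mu)\subset[-t,t]$, where $\mu$ is a measure on $\mathbb{R}$ with finite moments of all orders and $\mathrm{d}\mu(x)=B(x)\,\mathrm{d}x$ with $B$ a bounded nonnegative function. Define weights $w=\{w_k\}_{k=0}^\infty$ by $w_k:=t^{2k}$. Then the operators $F:\ell^2(w)\to L^2(\mu)$, $F_w^*:L^2(\mu)\to\ell^2(w)$, $F_w^*F$ and $FF_w^*$ are bounded, and the operator norm of $F_w^*F$ and of $FF_w^*$ is bounded above by $t\pi\|B\|_\infty$.
   Context: $\ell^2(w)=\{c:\sum_kw_k|c_k|^2<\infty\}$ with $\langle c|d\rangle_{\ell^2(w)}=\sum_kw_k\overline{c_k}d_k$. $F$ is (the closure of) the operator from $\ell^2(w)$ to $L^2(\mu)$ defined on finitely supported sequences by $Fc(x)=\sum_kc_kx^k$, and $F_w^*$ is its adjoint, $(F_w^*\phi)_k=\frac1{w_k}\int x^k\phi(x)\,\mathrm{d}\mu(x)$. *)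

theory Defs
  imports "HOL-Analysis.Analysis" "HOL-Probability.Essential_Supremum"
begin

text \<open>
  Both Hilbert spaces consist of complex-valued functions. As usual, elements of
  \<open>L\<^sup>2(\<mu>)\<close> are represented by square-integrable functions rather than by their
  almost-everywhere classes, so vectors are to be identified when their difference has
  norm 0. Inner products are conjugate-linear in the first argument.
\<close>

record 'a ip_space =
  vectors :: "('a \<Rightarrow> complex) set"
  ip :: "('a \<Rightarrow> complex) \<Rightarrow> ('a \<Rightarrow> complex) \<Rightarrow> complex"

definition ip_norm :: "'a ip_space \<Rightarrow> ('a \<Rightarrow> complex) \<Rightarrow> real" where
  "ip_norm X x = sqrt (Re (ip X x x))"

definition ip_dist :: "'a ip_space \<Rightarrow> ('a \<Rightarrow> complex) \<Rightarrow> ('a \<Rightarrow> complex) \<Rightarrow> real" where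
  "ip_dist X x y = ip_norm X (\<lambda>i. x i - y i)"

definition ell2 :: "(nat \<Rightarrow> real) \<Rightarrow> nat ip_space" where
  "ell2 w = \<lparr> vectors = {c. summable (\<lambda>k. w k * (cmod (c k))\<^sup>2)},
              ip = (\<lambda>c d. \<Sum>k. of_real (w k) * cnj (c k) * d k) \<rparr>"

definition L2 :: "'a measure \<Rightarrow> 'a ip_space" where
  "L2 M = \<lparr> vectors = {f \<in> borel_measurable M. integrable M (\<lambda>x. (cmod (f x))\<^sup>2)},
            ip = (\<lambda>f g. LINT x|M. cnj (f x) * g x) \<rparr>"

text \<open>
  Operators, possibly unbounded and only partially defined, are given by their graphs;
  accordingly the operator \<open>S T\<close> (first \<open>T\<close>, then \<open>S\<close>) is the relational composition
  \<open>T O S\<close>. Since vectors are only determined up to norm 0, graphs are single-valued only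
  up to norm 0, which is the last clause of \<open>linear_operator\<close>.
\<close>

type_synonym ('a, 'b) graph = "(('a \<Rightarrow> complex) \<times> ('b \<Rightarrow> complex)) set"

definition linear_operator :: "'a ip_space \<Rightarrow> 'b ip_space \<Rightarrow> ('a, 'b) graph \<Rightarrow> bool" where
  "linear_operator X Y T \<longleftrightarrow>
     T \<subseteq> vectors X \<times> vectors Y \<and>
     ((\<lambda>_. 0), (\<lambda>_. 0)) \<in> T \<and>
     (\<forall>x y x' y' a b. (x, y) \<in> T \<and> (x', y') \<in> T \<longrightarrow>
        ((\<lambda>i. a * x i + b * x' i), (\<lambda>j. a * y j + b * y' j)) \<in> T) \<and>
     (\<forall>x y x' y'. (x, y) \<in> T \<and> (x', y') \<in> T \<and> ip_dist X x x' = 0 \<longrightarrow> ip_dist Y y y' = 0)"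

text \<open>A bounded operator from \<open>X\<close> to \<open>Y\<close> is required to be defined on all of \<open>X\<close>.\<close>

definition bounded_operator :: "'a ip_space \<Rightarrow> 'b ip_space \<Rightarrow> ('a, 'b) graph \<Rightarrow> bool" where
  "bounded_operator X Y T \<longleftrightarrow>
     linear_operator X Y T \<and> Domain T = vectors X \<and>
     (\<exists>C. \<forall>(x, y) \<in> T. ip_norm Y y \<le> C * ip_norm X x)"

definition operator_norm :: "'a ip_space \<Rightarrow> 'b ip_space \<Rightarrow> ('a, 'b) graph \<Rightarrow> real" where
  "operator_norm X Y T = Sup {ip_norm Y y | x y. (x, y) \<in> T \<and> ip_norm X x \<le> 1}"

definition operator_closure :: "'a ip_space \<Rightarrow> 'b ip_space \<Rightarrow> ('a, 'b) graph \<Rightarrow> ('a, 'b) graph" where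
  "operator_closure X Y T =
     {(x, y) \<in> vectors X \<times> vectors Y.
        \<exists>u v. (\<forall>n. (u n, v n) \<in> T) \<and>
              (\<lambda>n. ip_dist X (u n) x) \<longlonglongrightarrow> 0 \<and> (\<lambda>n. ip_dist Y (v n) y) \<longlonglongrightarrow> 0}"

definition adjoint_operator :: "'a ip_space \<Rightarrow> 'b ip_space \<Rightarrow> ('a, 'b) graph \<Rightarrow> ('b, 'a) graph" where
  "adjoint_operator X Y T =
     {(y, x) \<in> vectors Y \<times> vectors X. \<forall>(u, v) \<in> T. ip Y v y = ip X u x}"

definition F_finite :: "(nat, real) graph" where
  "F_finite = {(c, \<lambda>x. \<Sum>k | c k \<noteq> 0. c k * of_real x ^ k) | c. finite {k. c k \<noteq> 0}}"

definition F_op :: "(nat \<Rightarrow> real) \<Rightarrow> real measure \<Rightarrow> (nat, real) graph" where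
  "F_op w \<mu> = operator_closure (ell2 w) (L2 \<mu>) F_finite"

definition F_adj :: "(nat \<Rightarrow> real) \<Rightarrow> real measure \<Rightarrow> (real, nat) graph" where
  "F_adj w \<mu> = adjoint_operator (ell2 w) (L2 \<mu>) (F_op w \<mu>)"

definition measure_support :: "'a::topological_space measure \<Rightarrow> 'a set" where
  "measure_support M = {x. \<forall>U. open U \<and> x \<in> U \<longrightarrow> emeasure M U > 0}"

lemma F_adj_formula:
  fixes \<mu> :: "real measure"
  assumes sets: "sets \<mu> = sets borel"
    and mom: "\<And>k::nat. integrable \<mu> (\<lambda>x. x ^ k)"
    and w: "w k > 0"
    and g: "(\<phi>, c) \<in> F_adj w \<mu>"
  shows "c k = of_real (1 / w k) * (LINT x|\<mu>. of_real (x ^ k) * \<phi> x)"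
proof -
  define e :: "nat \<Rightarrow> complex" where "e = (\<lambda>j. if j = k then 1 else 0)"
  define p :: "real \<Rightarrow> complex" where "p = (\<lambda>x. of_real (x ^ k))"
  have supp: "{j. e j \<noteq> 0} = {k}" by (auto simp: e_def)
  have ep: "(e, p) \<in> F_finite"
    unfolding F_finite_def
    by (intro CollectI exI[of _ e]) (simp add: supp, simp add: e_def p_def)
  have "summable (\<lambda>j. w j * (cmod (e j))\<^sup>2)"
    by (rule summable_finite[of "{k}"]) (auto simp: e_def)
  moreover have "p \<in> borel_measurable \<mu>"
    unfolding p_def measurable_cong_sets[OF sets refl] by measurable
  moreover have "integrable \<mu> (\<lambda>x. (cmod (p x))\<^sup>2)"
  proof -
    have "(cmod (p x))\<^sup>2 = x ^ (2 * k)" for x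
    proof -
      have "(cmod (p x))\<^sup>2 = \<bar>x ^ k\<bar>\<^sup>2"
        unfolding p_def by (simp only: norm_of_real)
      then show ?thesis
        by (simp only: power2_abs power_mult[symmetric] mult.commute)
    qed
    then show ?thesis using mom[of "2 * k"] by simp
  qed
  ultimately have "(e, p) \<in> F_op w \<mu>"
    using ep unfolding F_op_def operator_closure_def
    by (auto simp: ell2_def L2_def ip_dist_def ip_norm_def
             intro!: exI[of _ "\<lambda>_. e"] exI[of _ "\<lambda>_. p"])
  with g have "ip (L2 \<mu>) p \<phi> = ip (ell2 w) e c"
    unfolding F_adj_def adjoint_operator_def by blast
  moreover have "ip (ell2 w) e c = of_real (w k) * c k"
    using suminf_finite[of "{k}" "\<lambda>j. of_real (w j) * cnj (e j) * c j"]
    by (simp add: ell2_def e_def)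
  ultimately show ?thesis
    using w by (simp add: L2_def p_def field_simps)
qed

end

theory Submission
  imports Defs
begin

text \<open>
  By the Fejer-Riesz inequality (the integral of \<open>\<bar>p\<bar>\<^sup>2\<close> over a diameter is at most half its integral
  over the circle of radius \<open>t\<close>) together with Parseval, \<open>\<parallel>F c\<parallel>\<^sup>2 \<le> t \<pi> \<parallel>B\<parallel> \<parallel>c\<parallel>\<^sup>2\<close> for finitely
  supported \<open>c\<close>. So \<open>F\<close> extends to all of \<open>\<ell>\<^sup>2(w)\<close> with norm at most \<open>K = sqrt (t \<pi> \<parallel>B\<parallel>)\<close>,
  the adjoint has the same bound, and both products have norm at most \<open>K\<^sup>2\<close>.
\<close>

section \<open>Operators between semi-inner-product spaces\<close>

text \<open>The weights make the sum of w_k |c_k|^2 equal, up to the factor 2 pi, to the integral of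
  |p|^2 in the angle over the circle of radius t. Arc length contributes a factor t, and the half
  gained on the diameter leaves t pi. Bounding the density almost everywhere by its essential
  supremum turns the norm of a polynomial in L2(\<mu>) into a Lebesgue integral over [-t, t]. The
  other difficulty is to leave the finite sequences. The extension is made concrete: F c is the
  pointwise sum of the power series, which converges for |x| < t, and the end points are null
  because \<mu> has a density. The adjoint is explicit too: it sends g to the moments <x^k, g>
  divided by w_k, and the polynomial bound itself shows that this sequence lies in the weighted
  space. Vectors of L2 are functions rather than classes, so a nonzero vector may have norm 0. The
  abstract theory therefore assumes only semidefinite forms and identifies vectors up to norm
  0.\<close>

locale semi_ip_space =
  fixes X :: "'a ip_space"
  assumes zero_vec: "(\<lambda>_. 0) \<in> vectors X"
    and lin_vec: "x \<in> vectors X \<Longrightarrow> y \<in> vectors X \<Longrightarrow> (\<lambda>i. a * x i + b * y i) \<in> vectors X"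
    and ip_lin: "z \<in> vectors X \<Longrightarrow> x \<in> vectors X \<Longrightarrow> y \<in> vectors X \<Longrightarrow>
      ip X z (\<lambda>i. a * x i + b * y i) = a * ip X z x + b * ip X z y"
    and ip_cnj: "x \<in> vectors X \<Longrightarrow> y \<in> vectors X \<Longrightarrow> ip X y x = cnj (ip X x y)"
    and ip_nonneg: "x \<in> vectors X \<Longrightarrow> 0 \<le> Re (ip X x x)"
begin

lemma ip_lin_left:
  assumes "z \<in> vectors X" "x \<in> vectors X" "y \<in> vectors X"
  shows "ip X (\<lambda>i. a * x i + b * y i) z = cnj a * ip X x z + cnj b * ip X y z"
proof -
  have "ip X (\<lambda>i. a * x i + b * y i) z = cnj (ip X z (\<lambda>i. a * x i + b * y i))"
    using assms ip_cnj lin_vec by blast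
  then show ?thesis
    using assms ip_cnj[of z x] ip_cnj[of z y] by (simp add: ip_lin)
qed

lemma diff_vec: "x \<in> vectors X \<Longrightarrow> y \<in> vectors X \<Longrightarrow> (\<lambda>i. x i - y i) \<in> vectors X"
  using lin_vec[of x y 1 "-1"] by simp

lemma ip_diff_left:
  "z \<in> vectors X \<Longrightarrow> x \<in> vectors X \<Longrightarrow> y \<in> vectors X \<Longrightarrow>
    ip X (\<lambda>i. x i - y i) z = ip X x z - ip X y z"
  using ip_lin_left[of z x y 1 "-1"] by simp

lemma ip_zero_right: "z \<in> vectors X \<Longrightarrow> ip X z (\<lambda>_. 0) = 0"
  using ip_lin[of z z z 0 0] by simp

lemma ip_norm_nonneg: "x \<in> vectors X \<Longrightarrow> 0 \<le> ip_norm X x"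
  by (simp add: ip_norm_def ip_nonneg)

lemma ip_norm_sq: "x \<in> vectors X \<Longrightarrow> (ip_norm X x)\<^sup>2 = Re (ip X x x)"
  by (simp add: ip_norm_def ip_nonneg)

lemma ip_norm_zero: "ip_norm X (\<lambda>_. 0) = 0"
  by (simp add: ip_norm_def ip_zero_right zero_vec)

lemma ip_dist_self: "ip_dist X x x = 0"
  by (simp add: ip_dist_def ip_norm_zero)

lemma ip_norm_lin_sq:
  assumes "x \<in> vectors X" "y \<in> vectors X"
  shows "(ip_norm X (\<lambda>i. a * x i + b * y i))\<^sup>2 =
    (cmod a)\<^sup>2 * (ip_norm X x)\<^sup>2 + 2 * Re (cnj a * b * ip X x y) + (cmod b)\<^sup>2 * (ip_norm X y)\<^sup>2"
proof -
  have sq: "Re (cnj c * c * ip X z z) = (cmod c)\<^sup>2 * Re (ip X z z)" for c z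
  proof -
    have "cnj c * c = of_real ((cmod c)\<^sup>2)"
      unfolding complex_norm_square by (rule mult.commute)
    then show ?thesis by simp
  qed
  have "ip X (\<lambda>i. a * x i + b * y i) (\<lambda>i. a * x i + b * y i) =
     cnj a * a * ip X x x + (cnj a * b * ip X x y + cnj (cnj a * b * ip X x y)) + cnj b * b * ip X y y"
    using assms ip_cnj[of x y]
    by (simp add: ip_lin_left ip_lin lin_vec algebra_simps)
  moreover have "Re (z + cnj z) = 2 * Re z" for z
    by simp
  \<comment> \<open>\<open>Re\<close> is distributed only over the outer sums, so that the cross
    term stays in the shape \<open>z + cnj z\<close>.\<close>
  ultimately show ?thesis
    using assms by (simp only: ip_norm_sq lin_vec sq plus_complex.sel(1)[of "_ + _"]
      plus_complex.sel(1)[of "_ * ip X x x"])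
qed

text \<open>A unimodular factor \<open>u\<close> makes the inner product real and nonnegative. The
  squared norm of x - r u y is then a real quadratic in \<open>r\<close> that is never
  negative.\<close>

lemma Cauchy_Schwarz:
  assumes x: "x \<in> vectors X" and y: "y \<in> vectors X"
  shows "cmod (ip X x y) \<le> ip_norm X x * ip_norm X y"
proof -
  define s where "s = cmod (ip X x y)"
  define A where "A = (ip_norm X x)\<^sup>2"
  define D where "D = (ip_norm X y)\<^sup>2"
  obtain u where u: "cmod u = 1" "u * ip X x y = of_real s"
  proof (cases "ip X x y = 0")
    case True
    then show ?thesis using that[of 1] by (simp add: s_def)
  next
    case False
    show ?thesis
    proof (rule that[of "cnj (ip X x y) / of_real s"])
      show "cmod (cnj (ip X x y) / of_real s) = 1"
        using False by (simp add: s_def norm_divide)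
      show "cnj (ip X x y) / of_real s * ip X x y = of_real s"
        using False complex_norm_square[of "ip X x y"]
        by (simp add: s_def field_simps power2_eq_square)
    qed
  qed
  have q: "0 \<le> A - 2 * r * s + r\<^sup>2 * D" for r
  proof -
    have "(ip_norm X (\<lambda>i. 1 * x i + (- of_real r * u) * y i))\<^sup>2 =
      A + 2 * Re (- of_real r * (u * ip X x y)) + r\<^sup>2 * D"
      using u(1) by (subst ip_norm_lin_sq[OF x y]) (simp add: A_def D_def norm_mult mult.assoc)
    then have "(ip_norm X (\<lambda>i. 1 * x i + (- of_real r * u) * y i))\<^sup>2 = A - 2 * r * s + r\<^sup>2 * D"
      by (simp add: u(2))
    then show ?thesis
      by (metis zero_le_power2)
  qed
  have "s\<^sup>2 \<le> A * D"
  proof (cases "D = 0")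
    case True
    \<comment> \<open>In a semidefinite form \<open>D = 0\<close> can occur for nonzero
      \<open>y\<close>. The quadratic is then affine in \<open>r\<close>, and a nonzero slope would
      bring it down to -1 at the chosen \<open>r\<close>.\<close>
    have "s = 0"
    proof (rule ccontr)
      assume "s \<noteq> 0"
      then show False
        using q[of "(A + 1) / (2 * s)"] True by simp
    qed
    then show ?thesis by (simp add: True)
  next
    case False
    then have "D > 0" by (simp add: D_def)
    \<comment> \<open>The value \<open>s / D\<close> is the minimizer of the quadratic.\<close>
    then show ?thesis
      using q[of "s / D"] by (simp add: field_simps power2_eq_square)
  qed
  then have "s\<^sup>2 \<le> (ip_norm X x * ip_norm X y)\<^sup>2"
    by (simp add: A_def D_def power_mult_distrib)
  then show ?thesis
    unfolding s_def using x y by (simp add: power2_le_iff_abs_le ip_norm_nonneg)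
qed

lemma ip_norm_lin_le:
  assumes "x \<in> vectors X" "y \<in> vectors X"
  shows "ip_norm X (\<lambda>i. a * x i + b * y i) \<le> cmod a * ip_norm X x + cmod b * ip_norm X y"
proof -
  have "Re (cnj a * b * ip X x y) \<le> cmod (cnj a * b * ip X x y)"
    by (rule complex_Re_le_cmod)
  also have "\<dots> = cmod a * cmod b * cmod (ip X x y)"
    by (simp add: norm_mult)
  also have "\<dots> \<le> cmod a * cmod b * (ip_norm X x * ip_norm X y)"
    by (intro mult_left_mono Cauchy_Schwarz assms) auto
  finally have "(ip_norm X (\<lambda>i. a * x i + b * y i))\<^sup>2 \<le>
      (cmod a * ip_norm X x + cmod b * ip_norm X y)\<^sup>2"
    by (simp only: ip_norm_lin_sq[OF assms]) (simp add: power2_eq_square algebra_simps)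
  then show ?thesis
    using assms by (simp add: power2_le_iff_abs_le ip_norm_nonneg)
qed

lemma ip_norm_diff_le:
  assumes "x \<in> vectors X" "y \<in> vectors X"
  shows "ip_norm X x \<le> ip_norm X y + ip_dist X x y"
  using ip_norm_lin_le[of y "\<lambda>i. x i - y i" 1 1] assms by (simp add: ip_dist_def diff_vec)

lemma ip_dist_commute:
  assumes "x \<in> vectors X" "y \<in> vectors X"
  shows "ip_dist X x y = ip_dist X y x"
proof -
  have "ip_dist X a b \<le> ip_dist X b a" if "a \<in> vectors X" "b \<in> vectors X" for a b
    using ip_norm_lin_le[of "\<lambda>i. b i - a i" "\<lambda>_. 0" "-1" 0] that
    by (simp add: ip_dist_def diff_vec zero_vec)
  with assms show ?thesis by (simp add: order_antisym)
qed

lemma ip_dist_lin_tendsto: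
  assumes "\<And>n. u n \<in> vectors X" "\<And>n. u' n \<in> vectors X" "x \<in> vectors X" "x' \<in> vectors X"
    and u: "(\<lambda>n. ip_dist X (u n) x) \<longlonglongrightarrow> 0" and u': "(\<lambda>n. ip_dist X (u' n) x') \<longlonglongrightarrow> 0"
  shows "(\<lambda>n. ip_dist X (\<lambda>i. a * u n i + b * u' n i) (\<lambda>i. a * x i + b * x' i)) \<longlonglongrightarrow> 0"
proof (rule tendsto_sandwich[where f = "\<lambda>_. 0" and
      h = "\<lambda>n. cmod a * ip_dist X (u n) x + cmod b * ip_dist X (u' n) x'"])
  show "(\<lambda>n. cmod a * ip_dist X (u n) x + cmod b * ip_dist X (u' n) x') \<longlonglongrightarrow> 0"
    using tendsto_add[OF tendsto_mult_left[OF u] tendsto_mult_left[OF u']] by simp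
  have eq: "(\<lambda>i. a * u n i + b * u' n i - (a * x i + b * x' i)) =
      (\<lambda>i. a * (u n i - x i) + b * (u' n i - x' i))" for n
    by (simp add: algebra_simps)
  show "\<forall>\<^sub>F n in sequentially. ip_dist X (\<lambda>i. a * u n i + b * u' n i) (\<lambda>i. a * x i + b * x' i)
      \<le> cmod a * ip_dist X (u n) x + cmod b * ip_dist X (u' n) x'"
    unfolding ip_dist_def eq using assms by (intro always_eventually allI ip_norm_lin_le diff_vec)
  show "\<forall>\<^sub>F n in sequentially. 0 \<le> ip_dist X (\<lambda>i. a * u n i + b * u' n i) (\<lambda>i. a * x i + b * x' i)"
    unfolding ip_dist_def eq using assms
    by (intro always_eventually allI ip_norm_nonneg lin_vec diff_vec)
qed simp

lemma ip_norm_tendsto: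
  assumes "\<And>n. u n \<in> vectors X" "x \<in> vectors X" and u: "(\<lambda>n. ip_dist X (u n) x) \<longlonglongrightarrow> 0"
  shows "(\<lambda>n. ip_norm X (u n)) \<longlonglongrightarrow> ip_norm X x"
proof -
  have "\<bar>ip_norm X (u n) - ip_norm X x\<bar> \<le> ip_dist X (u n) x" for n
    using ip_norm_diff_le[of "u n" x] ip_norm_diff_le[of x "u n"] assms ip_dist_commute[of x "u n"]
    by auto
  then have "(\<lambda>n. ip_norm X (u n) - ip_norm X x) \<longlonglongrightarrow> 0"
    by (intro Lim_null_comparison[OF _ u]) auto
  then show ?thesis by (simp add: LIM_zero_iff)
qed

lemma ip_tendsto:
  assumes "\<And>n. u n \<in> vectors X" "x \<in> vectors X" "y \<in> vectors X"
    and u: "(\<lambda>n. ip_dist X (u n) x) \<longlonglongrightarrow> 0"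
  shows "(\<lambda>n. ip X (u n) y) \<longlonglongrightarrow> ip X x y"
proof -
  have le: "cmod (ip X (u n) y - ip X x y) \<le> ip_dist X (u n) x * ip_norm X y" for n
    using Cauchy_Schwarz[of "\<lambda>i. u n i - x i" y] assms
    by (simp add: ip_dist_def ip_diff_left diff_vec)
  have lim: "(\<lambda>n. ip_dist X (u n) x * ip_norm X y) \<longlonglongrightarrow> 0"
    using tendsto_mult_right[OF u] by simp
  have "(\<lambda>n. ip X (u n) y - ip X x y) \<longlonglongrightarrow> 0"
    by (rule Lim_null_comparison[OF _ lim]) (simp add: le)
  then show ?thesis by (simp add: LIM_zero_iff)
qed

end

section \<open>Graphs of bounded operators: closure, adjoint, composition\<close>

locale semi_ip_space_pair = X: semi_ip_space X + Y: semi_ip_space Y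
  for X :: "'a ip_space" and Y :: "'b ip_space"
begin

text \<open>Single-valuedness up to norm 0 is a consequence of the bound, applied to the difference
  of two pairs of the graph.\<close>

lemma linear_operatorI:
  assumes sub: "T \<subseteq> vectors X \<times> vectors Y"
    and "((\<lambda>_. 0), (\<lambda>_. 0)) \<in> T"
    and lin: "\<And>x y x' y' a b. (x, y) \<in> T \<Longrightarrow> (x', y') \<in> T \<Longrightarrow>
        ((\<lambda>i. a * x i + b * x' i), (\<lambda>j. a * y j + b * y' j)) \<in> T"
    and bd: "\<And>x y. (x, y) \<in> T \<Longrightarrow> ip_norm Y y \<le> C * ip_norm X x"
  shows "linear_operator X Y T"
proof -
  have "ip_dist Y y y' = 0" if "(x, y) \<in> T" "(x', y') \<in> T" "ip_dist X x x' = 0" for x y x' y'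
  proof -
    have "ip_norm Y (\<lambda>j. y j - y' j) \<le> C * ip_norm X (\<lambda>i. x i - x' i)"
      using bd[OF lin[OF that(1,2), of 1 "-1"]] by simp
    moreover have "0 \<le> ip_norm Y (\<lambda>j. y j - y' j)"
      using that sub by (intro Y.ip_norm_nonneg Y.diff_vec) auto
    ultimately show ?thesis
      using that(3) by (simp add: ip_dist_def)
  qed
  with assms show ?thesis
    unfolding linear_operator_def by blast
qed

lemma operator_norm_le:
  assumes T: "linear_operator X Y T"
    and C: "0 \<le> C" and bd: "\<And>x y. (x, y) \<in> T \<Longrightarrow> ip_norm Y y \<le> C * ip_norm X x"
  shows "operator_norm X Y T \<le> C"
  unfolding operator_norm_def
proof (rule cSup_least)
  \<comment> \<open>The supremum of the empty set of reals is unspecified; the zero pair rules this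
    case out.\<close>
  have "((\<lambda>_. 0), (\<lambda>_. 0)) \<in> T"
    using T by (simp add: linear_operator_def)
  then show "{ip_norm Y y |x y. (x, y) \<in> T \<and> ip_norm X x \<le> 1} \<noteq> {}"
    using X.ip_norm_zero by fastforce
next
  fix z assume "z \<in> {ip_norm Y y |x y. (x, y) \<in> T \<and> ip_norm X x \<le> 1}"
  then obtain x y where "z = ip_norm Y y" "(x, y) \<in> T" "ip_norm X x \<le> 1"
    by blast
  then show "z \<le> C"
    using bd[of x y] mult_left_mono[of "ip_norm X x" 1 C] C by simp
qed

lemma operator_closure_bound:
  assumes T: "T \<subseteq> vectors X \<times> vectors Y"
    and bd: "\<And>x y. (x, y) \<in> T \<Longrightarrow> ip_norm Y y \<le> C * ip_norm X x"
    and xy: "(x, y) \<in> operator_closure X Y T"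
  shows "ip_norm Y y \<le> C * ip_norm X x"
proof -
  obtain u v where uv: "\<And>n. (u n, v n) \<in> T" "(\<lambda>n. ip_dist X (u n) x) \<longlonglongrightarrow> 0"
      "(\<lambda>n. ip_dist Y (v n) y) \<longlonglongrightarrow> 0" and v: "x \<in> vectors X" "y \<in> vectors Y"
    using xy by (auto simp: operator_closure_def)
  have vec: "u n \<in> vectors X" "v n \<in> vectors Y" for n
    using T uv(1)[of n] by auto
  have "(\<lambda>n. ip_norm Y (v n)) \<longlonglongrightarrow> ip_norm Y y"
    by (intro Y.ip_norm_tendsto vec v uv)
  moreover have "(\<lambda>n. C * ip_norm X (u n)) \<longlonglongrightarrow> C * ip_norm X x"
    by (intro tendsto_mult_left X.ip_norm_tendsto vec v uv)
  ultimately show ?thesis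
    by (rule LIMSEQ_le) (use bd[OF uv(1)] in auto)
qed

lemma operator_closure_superset: "T \<subseteq> vectors X \<times> vectors Y \<Longrightarrow> T \<subseteq> operator_closure X Y T"
proof (rule subrelI)
  fix x y assume "T \<subseteq> vectors X \<times> vectors Y" "(x, y) \<in> T"
  moreover have "(\<lambda>_::nat. ip_dist X x x) \<longlonglongrightarrow> 0" "(\<lambda>_::nat. ip_dist Y y y) \<longlonglongrightarrow> 0"
    by (simp_all add: X.ip_dist_self Y.ip_dist_self)
  ultimately show "(x, y) \<in> operator_closure X Y T"
    unfolding operator_closure_def
    by (intro CollectI case_prodI conjI exI[of _ "\<lambda>_. x"] exI[of _ "\<lambda>_. y"]) auto
qed

lemma linear_operator_closure:
  assumes T: "T \<subseteq> vectors X \<times> vectors Y" and zero: "((\<lambda>_. 0), (\<lambda>_. 0)) \<in> T"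
    and lin: "\<And>x y x' y' a b. (x, y) \<in> T \<Longrightarrow> (x', y') \<in> T \<Longrightarrow>
        ((\<lambda>i. a * x i + b * x' i), (\<lambda>j. a * y j + b * y' j)) \<in> T"
    and bd: "\<And>x y. (x, y) \<in> T \<Longrightarrow> ip_norm Y y \<le> C * ip_norm X x"
  shows "linear_operator X Y (operator_closure X Y T)"
proof (rule linear_operatorI)
  show "operator_closure X Y T \<subseteq> vectors X \<times> vectors Y"
    by (auto simp: operator_closure_def)
  show "((\<lambda>_. 0), (\<lambda>_. 0)) \<in> operator_closure X Y T"
    using zero operator_closure_superset[OF T] by blast
  show "ip_norm Y y \<le> C * ip_norm X x" if "(x, y) \<in> operator_closure X Y T" for x y
    by (rule operator_closure_bound[OF T bd that])
next
  fix x y x' y' a b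
  assume "(x, y) \<in> operator_closure X Y T" "(x', y') \<in> operator_closure X Y T"
  then obtain u v u' v' where
    uv: "\<And>n. (u n, v n) \<in> T" "(\<lambda>n. ip_dist X (u n) x) \<longlonglongrightarrow> 0" "(\<lambda>n. ip_dist Y (v n) y) \<longlonglongrightarrow> 0"
      "\<And>n. (u' n, v' n) \<in> T" "(\<lambda>n. ip_dist X (u' n) x') \<longlonglongrightarrow> 0" "(\<lambda>n. ip_dist Y (v' n) y') \<longlonglongrightarrow> 0"
    and v: "x \<in> vectors X" "y \<in> vectors Y" "x' \<in> vectors X" "y' \<in> vectors Y"
    unfolding operator_closure_def by blast
  have vec: "u n \<in> vectors X" "v n \<in> vectors Y" "u' n \<in> vectors X" "v' n \<in> vectors Y" for n
    using T uv(1)[of n] uv(4)[of n] by auto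
  show "((\<lambda>i. a * x i + b * x' i), (\<lambda>j. a * y j + b * y' j)) \<in> operator_closure X Y T"
    unfolding operator_closure_def
  proof (intro CollectI case_prodI conjI exI allI)
    show "((\<lambda>i. a * u n i + b * u' n i), (\<lambda>j. a * v n j + b * v' n j)) \<in> T" for n
      by (rule lin[OF uv(1,4)])
    show "(\<lambda>n. ip_dist X (\<lambda>i. a * u n i + b * u' n i) (\<lambda>i. a * x i + b * x' i)) \<longlonglongrightarrow> 0"
      by (rule X.ip_dist_lin_tendsto[OF vec(1,3) v(1,3) uv(2,5)])
    show "(\<lambda>n. ip_dist Y (\<lambda>j. a * v n j + b * v' n j) (\<lambda>j. a * y j + b * y' j)) \<longlonglongrightarrow> 0"
      by (rule Y.ip_dist_lin_tendsto[OF vec(2,4) v(2,4) uv(3,6)])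
  qed (simp add: X.lin_vec Y.lin_vec v)
qed

text \<open>Both sides of the adjoint relation are continuous in the pair taken from the graph.
  Thanks to this, the adjoint of the closed operator need only be tested on polynomials.\<close>

lemma adjoint_operator_closure:
  assumes T: "T \<subseteq> vectors X \<times> vectors Y"
    and yx: "(y, x) \<in> adjoint_operator X Y T"
  shows "(y, x) \<in> adjoint_operator X Y (operator_closure X Y T)"
proof -
  have v: "y \<in> vectors Y" "x \<in> vectors X" and eq: "\<And>u v. (u, v) \<in> T \<Longrightarrow> ip Y v y = ip X u x"
    using yx by (auto simp: adjoint_operator_def)
  have "ip Y b y = ip X a x" if ab: "(a, b) \<in> operator_closure X Y T" for a b
  proof -
    obtain u v where uv: "\<And>n. (u n, v n) \<in> T" "(\<lambda>n. ip_dist X (u n) a) \<longlonglongrightarrow> 0"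
        "(\<lambda>n. ip_dist Y (v n) b) \<longlonglongrightarrow> 0" and v': "a \<in> vectors X" "b \<in> vectors Y"
      using ab by (auto simp: operator_closure_def)
    have vec: "u n \<in> vectors X" "v n \<in> vectors Y" for n
      using T uv(1)[of n] by auto
    have "(\<lambda>n. ip Y (v n) y) \<longlonglongrightarrow> ip Y b y"
      by (intro Y.ip_tendsto vec v' uv v)
    moreover have "(\<lambda>n. ip Y (v n) y) \<longlonglongrightarrow> ip X a x"
      unfolding eq[OF uv(1)] by (intro X.ip_tendsto vec v' uv v)
    ultimately show ?thesis by (rule LIMSEQ_unique)
  qed
  with v show ?thesis by (auto simp: adjoint_operator_def)
qed

text \<open>Since \<open>T\<close> is defined everywhere, the adjoint relation may be tested on
  \<open>x\<close> itself. This bounds the square of the norm of \<open>x\<close> by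
  \<open>C\<close> times the norms of \<open>x\<close> and \<open>y\<close>, and one factor
  cancels.\<close>

lemma adjoint_operator_bound:
  assumes T: "T \<subseteq> vectors X \<times> vectors Y" "Domain T = vectors X"
    and bd: "\<And>x y. (x, y) \<in> T \<Longrightarrow> ip_norm Y y \<le> C * ip_norm X x"
    and C: "0 \<le> C"
    and yx: "(y, x) \<in> adjoint_operator X Y T"
  shows "ip_norm X x \<le> C * ip_norm Y y"
proof -
  have v: "y \<in> vectors Y" "x \<in> vectors X" and eq: "\<And>u v. (u, v) \<in> T \<Longrightarrow> ip Y v y = ip X u x"
    using yx by (auto simp: adjoint_operator_def)
  have "x \<in> Domain T"
    using v T(2) by simp
  then obtain z where z: "(x, z) \<in> T" "z \<in> vectors Y"
    using T(1) by blast
  have "(ip_norm X x)\<^sup>2 = Re (ip Y z y)"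
    using X.ip_norm_sq[OF v(2)] eq[OF z(1)] by simp
  also have "\<dots> \<le> ip_norm Y z * ip_norm Y y"
    by (rule order_trans[OF complex_Re_le_cmod Y.Cauchy_Schwarz[OF z(2) v(1)]])
  also have "\<dots> \<le> C * ip_norm X x * ip_norm Y y"
    by (intro mult_right_mono bd z Y.ip_norm_nonneg v)
  finally have *: "ip_norm X x * ip_norm X x \<le> ip_norm X x * (C * ip_norm Y y)"
    by (simp add: power2_eq_square mult_ac)
  show ?thesis
  proof (cases "ip_norm X x = 0")
    case True
    then show ?thesis using C Y.ip_norm_nonneg[OF v(1)] by simp
  next
    case False
    then show ?thesis using * X.ip_norm_nonneg[OF v(2)] by simp
  qed
qed

end

text \<open>Serves the product on L2, where the adjoint acts before F and the two spaces exchange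
  roles.\<close>

lemma semi_ip_space_pair_commute: "semi_ip_space_pair X Y \<Longrightarrow> semi_ip_space_pair Y X"
  by (simp add: semi_ip_space_pair_def)

context semi_ip_space_pair
begin

lemma linear_operator_adjoint:
  assumes T: "T \<subseteq> vectors X \<times> vectors Y" "Domain T = vectors X"
    and bd: "\<And>x y. (x, y) \<in> T \<Longrightarrow> ip_norm Y y \<le> C * ip_norm X x"
    and C: "0 \<le> C"
  shows "linear_operator Y X (adjoint_operator X Y T)"
proof -
  interpret YX: semi_ip_space_pair Y X ..
  have v: "u \<in> vectors X" "v \<in> vectors Y" if "(u, v) \<in> T" for u v
    using T that by auto
  show ?thesis
  proof (rule YX.linear_operatorI[where C = C])
    show "adjoint_operator X Y T \<subseteq> vectors Y \<times> vectors X"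
      by (auto simp: adjoint_operator_def)
    show "((\<lambda>_. 0), (\<lambda>_. 0)) \<in> adjoint_operator X Y T"
      using v by (auto simp: adjoint_operator_def X.ip_zero_right Y.ip_zero_right X.zero_vec Y.zero_vec)
    show "ip_norm X x \<le> C * ip_norm Y y" if "(y, x) \<in> adjoint_operator X Y T" for x y
      by (rule adjoint_operator_bound[OF T bd C that])
    show "((\<lambda>i. a * x i + b * x' i), (\<lambda>j. a * y j + b * y' j)) \<in> adjoint_operator X Y T"
      if "(x, y) \<in> adjoint_operator X Y T" "(x', y') \<in> adjoint_operator X Y T" for x y x' y' a b
    proof -
      have *: "x \<in> vectors Y" "y \<in> vectors X" "x' \<in> vectors Y" "y' \<in> vectors X"
        and eq: "\<And>p q. (p, q) \<in> T \<Longrightarrow> ip Y q x = ip X p y"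
          "\<And>p q. (p, q) \<in> T \<Longrightarrow> ip Y q x' = ip X p y'"
        using that by (auto simp: adjoint_operator_def)
      have "ip Y q (\<lambda>i. a * x i + b * x' i) = ip X p (\<lambda>j. a * y j + b * y' j)"
        if "(p, q) \<in> T" for p q
        using * v[OF that] eq[OF that] by (simp add: X.ip_lin Y.ip_lin)
      with * show ?thesis
        by (auto simp: adjoint_operator_def X.lin_vec Y.lin_vec)
    qed
  qed
qed

text \<open>Kept general in \<open>Z\<close>; both products of F and its adjoint are the case in
  which \<open>Z\<close> is again the first space.\<close>

lemma bounded_operator_comp:
  assumes Z: "semi_ip_space Z"
    and S: "linear_operator X Y S" "Domain S = vectors X"
      "\<And>x y. (x, y) \<in> S \<Longrightarrow> ip_norm Y y \<le> C * ip_norm X x"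
    and T: "linear_operator Y Z T" "Domain T = vectors Y"
      "\<And>y z. (y, z) \<in> T \<Longrightarrow> ip_norm Z z \<le> D * ip_norm Y y"
    and CD: "0 \<le> C" "0 \<le> D"
  shows "bounded_operator X Z (S O T)" "operator_norm X Z (S O T) \<le> D * C"
proof -
  interpret Z: semi_ip_space Z by (rule Z)
  interpret XZ: semi_ip_space_pair X Z ..
  have bd: "ip_norm Z z \<le> D * C * ip_norm X x" if "(x, z) \<in> S O T" for x z
  proof -
    obtain y where "(x, y) \<in> S" "(y, z) \<in> T"
      using \<open>(x, z) \<in> S O T\<close> by auto
    then show ?thesis
      using S(3)[of x y] T(3)[of y z] mult_left_mono[OF S(3)[of x y] CD(2)] by (simp add: mult.assoc)
  qed
  have sub: "S \<subseteq> vectors X \<times> vectors Y" "T \<subseteq> vectors Y \<times> vectors Z"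
    using S(1) T(1) by (auto simp: linear_operator_def)
  have lin: "linear_operator X Z (S O T)"
  proof (rule XZ.linear_operatorI[OF _ _ _ bd])
    show "S O T \<subseteq> vectors X \<times> vectors Z"
      using sub by auto
    show "((\<lambda>_. 0), (\<lambda>_. 0)) \<in> S O T"
      using S(1) T(1) unfolding linear_operator_def by (intro relcompI) blast+
    show "((\<lambda>i. a * x i + b * x' i), (\<lambda>j. a * y j + b * y' j)) \<in> S O T"
      if "(x, y) \<in> S O T" "(x', y') \<in> S O T" for x y x' y' a b
    proof -
      from that obtain z z' where "(x, z) \<in> S" "(z, y) \<in> T" "(x', z') \<in> S" "(z', y') \<in> T"
        by auto
      then show ?thesis
        using S(1) T(1) unfolding linear_operator_def
        by (intro relcompI[where b = "\<lambda>i. a * z i + b * z' i"]) blast+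
    qed
  qed
  have "Domain (S O T) = vectors X"
  proof (rule set_eqI)
    fix x
    have "\<exists>z. (y, z) \<in> T" if "(x, y) \<in> S" for y
      using that sub(1) T(2) by (metis DomainE mem_Sigma_iff subsetD)
    then show "x \<in> Domain (S O T) \<longleftrightarrow> x \<in> vectors X"
      unfolding S(2)[symmetric] by blast
  qed
  with lin bd show "bounded_operator X Z (S O T)"
    unfolding bounded_operator_def by auto
  show "operator_norm X Z (S O T) \<le> D * C"
    by (rule XZ.operator_norm_le[OF lin _ bd]) (use CD in auto)
qed

end

section \<open>The concrete spaces: L2 of a measure and weighted sequences\<close>

lemma cmod_lin_sq_le: "(cmod (a * x + b * y))\<^sup>2 \<le> 2 * (cmod a)\<^sup>2 * (cmod x)\<^sup>2 + 2 * (cmod b)\<^sup>2 * (cmod y)\<^sup>2"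
proof -
  have "(cmod (a * x + b * y))\<^sup>2 \<le> (cmod a * cmod x + cmod b * cmod y)\<^sup>2"
    using norm_triangle_ineq[of "a * x" "b * y"] by (intro power_mono) (auto simp: norm_mult)
  also have "\<dots> \<le> 2 * (cmod a * cmod x)\<^sup>2 + 2 * (cmod b * cmod y)\<^sup>2"
    using sum_squares_bound[of "cmod a * cmod x" "cmod b * cmod y"] by (simp add: power2_sum)
  finally show ?thesis by (simp add: power_mult_distrib)
qed

text \<open>The domination that makes the inner products of both concrete spaces converge
  absolutely.\<close>

lemma cmod_cnj_mult_le: "cmod (cnj x * y) \<le> (cmod x)\<^sup>2 + (cmod y)\<^sup>2"
proof -
  have "0 \<le> cmod x * cmod y" "cmod (cnj x * y) = cmod x * cmod y"
    by (simp_all add: norm_mult)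
  then show ?thesis
    using sum_squares_bound[of "cmod x" "cmod y"] by linarith
qed

lemma semi_ip_space_L2: "semi_ip_space (L2 M)"
proof -
  have int: "integrable M (\<lambda>x. cnj (f x) * g x)"
    if "f \<in> vectors (L2 M)" "g \<in> vectors (L2 M)" for f g
  proof (rule Bochner_Integration.integrable_bound)
    show "integrable M (\<lambda>x. (cmod (f x))\<^sup>2 + (cmod (g x))\<^sup>2)"
      using that by (simp add: L2_def)
    show "AE x in M. norm (cnj (f x) * g x) \<le> norm ((cmod (f x))\<^sup>2 + (cmod (g x))\<^sup>2)"
      using cmod_cnj_mult_le by (intro always_eventually allI) (metis abs_of_nonneg norm_ge_zero order_trans real_norm_def)
  next
    have "f \<in> borel_measurable M" "g \<in> borel_measurable M"
      using that by (auto simp: L2_def)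
    then show "(\<lambda>x. cnj (f x) * g x) \<in> borel_measurable M"
      by (intro borel_measurable_times borel_measurable_continuous_on[where f = cnj])
        (auto intro: continuous_intros)
  qed
  show ?thesis
  proof
    show "(\<lambda>_. 0) \<in> vectors (L2 M)" by (simp add: L2_def)
  next
    fix f g a b assume fg: "f \<in> vectors (L2 M)" "g \<in> vectors (L2 M)"
    then have [measurable]: "f \<in> borel_measurable M" "g \<in> borel_measurable M"
      by (auto simp: L2_def)
    have "integrable M (\<lambda>x. (cmod (a * f x + b * g x))\<^sup>2)"
    proof (rule Bochner_Integration.integrable_bound)
      show "integrable M (\<lambda>x. 2 * (cmod a)\<^sup>2 * (cmod (f x))\<^sup>2 + 2 * (cmod b)\<^sup>2 * (cmod (g x))\<^sup>2)"
        using fg by (simp add: L2_def)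
      show "AE x in M. norm ((cmod (a * f x + b * g x))\<^sup>2) \<le>
          norm (2 * (cmod a)\<^sup>2 * (cmod (f x))\<^sup>2 + 2 * (cmod b)\<^sup>2 * (cmod (g x))\<^sup>2)"
        using cmod_lin_sq_le by (intro always_eventually allI) simp
    qed measurable
    then show "(\<lambda>i. a * f i + b * g i) \<in> vectors (L2 M)"
      by (simp add: L2_def)
  next
    fix h f g a b
    assume "h \<in> vectors (L2 M)" "f \<in> vectors (L2 M)" "g \<in> vectors (L2 M)"
    note i = int[OF this(1,2)] int[OF this(1,3)]
    have "cnj (h x) * (a * f x + b * g x) = a * (cnj (h x) * f x) + b * (cnj (h x) * g x)" for x
      by (simp add: algebra_simps)
    then show "ip (L2 M) h (\<lambda>i. a * f i + b * g i) = a * ip (L2 M) h f + b * ip (L2 M) h g"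
      using i by (simp add: L2_def)
  next
    fix f g assume "f \<in> vectors (L2 M)" "g \<in> vectors (L2 M)"
    have "(LINT x|M. cnj (cnj (f x) * g x)) = cnj (LINT x|M. cnj (f x) * g x)"
      by (rule Bochner_Integration.integral_cnj)
    then show "ip (L2 M) g f = cnj (ip (L2 M) f g)"
      by (simp add: L2_def mult.commute)
  next
    fix f assume "f \<in> vectors (L2 M)"
    note i = int[OF this this]
    have "Re (ip (L2 M) f f) = (LINT x|M. Re (cnj (f x) * f x))"
      using i by (simp add: L2_def del: times_complex.sel)
    also have "\<dots> \<ge> 0"
      by (intro integral_nonneg_AE) simp
    finally show "0 \<le> Re (ip (L2 M) f f)" .
  qed
qed

lemma semi_ip_space_ell2:
  assumes w: "\<And>k. 0 \<le> w k"
  shows "semi_ip_space (ell2 w)"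
proof -
  have int: "summable (\<lambda>k. of_real (w k) * cnj (f k) * g k)"
    if "f \<in> vectors (ell2 w)" "g \<in> vectors (ell2 w)" for f g
  proof (rule summable_comparison_test)
    show "summable (\<lambda>k. w k * (cmod (f k))\<^sup>2 + w k * (cmod (g k))\<^sup>2)"
      using that by (intro summable_add) (auto simp: ell2_def)
    have "norm (of_real (w k) * cnj (f k) * g k) \<le> w k * (cmod (f k))\<^sup>2 + w k * (cmod (g k))\<^sup>2" for k
      using mult_left_mono[OF cmod_cnj_mult_le[of "f k" "g k"] w[of k]] w[of k]
      by (simp add: norm_mult algebra_simps)
    then show "\<exists>N. \<forall>n\<ge>N. norm (of_real (w n) * cnj (f n) * g n) \<le> w n * (cmod (f n))\<^sup>2 + w n * (cmod (g n))\<^sup>2"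
      by blast
  qed
  show ?thesis
  proof
    show "(\<lambda>_. 0) \<in> vectors (ell2 w)" by (simp add: ell2_def)
  next
    fix f g a b assume fg: "f \<in> vectors (ell2 w)" "g \<in> vectors (ell2 w)"
    have "summable (\<lambda>k. w k * (cmod (a * f k + b * g k))\<^sup>2)"
    proof (rule summable_comparison_test)
      show "summable (\<lambda>k. 2 * (cmod a)\<^sup>2 * (w k * (cmod (f k))\<^sup>2) + 2 * (cmod b)\<^sup>2 * (w k * (cmod (g k))\<^sup>2))"
        using fg by (intro summable_add summable_mult) (auto simp: ell2_def)
      have "norm (w k * (cmod (a * f k + b * g k))\<^sup>2)
        \<le> 2 * (cmod a)\<^sup>2 * (w k * (cmod (f k))\<^sup>2) + 2 * (cmod b)\<^sup>2 * (w k * (cmod (g k))\<^sup>2)" for k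
        using mult_left_mono[OF cmod_lin_sq_le[of a "f k" b "g k"] w[of k]] w[of k]
        by (simp add: algebra_simps abs_mult)
      then show "\<exists>N. \<forall>k\<ge>N. norm (w k * (cmod (a * f k + b * g k))\<^sup>2)
        \<le> 2 * (cmod a)\<^sup>2 * (w k * (cmod (f k))\<^sup>2) + 2 * (cmod b)\<^sup>2 * (w k * (cmod (g k))\<^sup>2)"
        by blast
    qed
    then show "(\<lambda>i. a * f i + b * g i) \<in> vectors (ell2 w)"
      by (simp add: ell2_def)
  next
    fix h f g a b
    assume "h \<in> vectors (ell2 w)" "f \<in> vectors (ell2 w)" "g \<in> vectors (ell2 w)"
    note i = int[OF this(1,2)] int[OF this(1,3)]
    have "of_real (w k) * cnj (h k) * (a * f k + b * g k) =
        a * (of_real (w k) * cnj (h k) * f k) + b * (of_real (w k) * cnj (h k) * g k)" for k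
      by (simp add: algebra_simps)
    then show "ip (ell2 w) h (\<lambda>i. a * f i + b * g i) = a * ip (ell2 w) h f + b * ip (ell2 w) h g"
      using i by (simp add: ell2_def suminf_add[symmetric] suminf_mult summable_mult)
  next
    fix f g assume fg: "f \<in> vectors (ell2 w)" "g \<in> vectors (ell2 w)"
    have "(\<lambda>k. cnj (of_real (w k) * cnj (f k) * g k)) sums cnj (\<Sum>k. of_real (w k) * cnj (f k) * g k)"
      unfolding sums_cnj by (rule summable_sums[OF int[OF fg]])
    then show "ip (ell2 w) g f = cnj (ip (ell2 w) f g)"
      by (simp add: ell2_def sums_iff mult_ac)
  next
    fix f assume "f \<in> vectors (ell2 w)"
    note i = int[OF this this]
    have "Re (ip (ell2 w) f f) = (\<Sum>k. Re (of_real (w k) * cnj (f k) * f k))"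
      using Re_suminf[OF i] by (simp add: ell2_def)
    also have "\<dots> \<ge> 0"
      by (intro suminf_nonneg summable_Re i) (simp add: w mult.assoc)
    finally show "0 \<le> Re (ip (ell2 w) f f)" .
  qed
qed

section \<open>The Fejer-Riesz inequality for polynomials\<close>

text \<open>Orthogonality already holds on the half interval, because the sine of an integer
  multiple of pi vanishes. The factor 2 comes from adding the contributions of \<theta> and
  -\<theta>.\<close>

lemma has_integral_cos_diff:
  "((\<lambda>\<theta>. 2 * cos ((real k - real l) * \<theta>)) has_integral (if k = l then 2 * pi else 0)) {0..pi}"
proof (cases "k = l")
  case True
  then show ?thesis
    using has_integral_const_real[of "2::real" 0 pi] by (simp add: mult.commute)
next
  case False
  define m where "m = real k - real l"
  have m: "m \<noteq> 0" using False by (simp add: m_def)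
  have "((\<lambda>\<theta>. 2 * cos (m * \<theta>)) has_integral (2 * sin (m * pi) / m - 2 * sin (m * 0) / m)) {0..pi}"
    using m by (intro fundamental_theorem_of_calculus)
      (auto intro!: derivative_eq_intros simp: has_real_derivative_iff_has_vector_derivative[symmetric])
  moreover have "sin (m * pi) = 0"
    by (auto simp: m_def left_diff_distrib sin_diff)
  ultimately show ?thesis
    using False by (simp add: m_def)
qed

text \<open>On a single semicircle the exponentials are not orthogonal. Adding the values at
  conjugate points leaves only cosines, which are. The two arcs share one parameter because the
  estimate on the arc pairs \<theta> with -\<theta> pointwise.\<close>

lemma has_integral_Parseval_semicircles:
  fixes a :: "nat \<Rightarrow> complex"
  shows "((\<lambda>\<theta>. (cmod (\<Sum>k<n. a k * cis \<theta> ^ k))\<^sup>2 + (cmod (\<Sum>k<n. a k * cis (- \<theta>) ^ k))\<^sup>2)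
    has_integral (2 * pi * (\<Sum>k<n. (cmod (a k))\<^sup>2))) {0..pi}"
proof -
  have sq: "complex_of_real ((cmod (\<Sum>k<n. a k * cis \<theta> ^ k))\<^sup>2) =
      (\<Sum>k<n. \<Sum>l<n. a k * cnj (a l) * cis ((real k - real l) * \<theta>))" for \<theta>
    unfolding complex_norm_square cnj_sum sum_product
    by (intro sum.cong refl) (simp add: Complex.DeMoivre cis_cnj cis_mult left_diff_distrib)
  have cc: "cis x + cis (- x) = of_real (2 * cos x)" for x
    by (simp add: complex_eq_iff)
  have eq: "complex_of_real ((cmod (\<Sum>k<n. a k * cis \<theta> ^ k))\<^sup>2 + (cmod (\<Sum>k<n. a k * cis (- \<theta>) ^ k))\<^sup>2)
     = (\<Sum>k<n. \<Sum>l<n. a k * cnj (a l) * of_real (2 * cos ((real k - real l) * \<theta>)))" for \<theta>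
    unfolding of_real_add sq sum.distrib[symmetric] cc[symmetric]
    by (intro sum.cong refl) (simp add: algebra_simps)
  have "((\<lambda>\<theta>. \<Sum>k<n. \<Sum>l<n. a k * cnj (a l) * of_real (2 * cos ((real k - real l) * \<theta>)))
     has_integral (\<Sum>k<n. \<Sum>l<n. a k * cnj (a l) * of_real (if k = l then 2 * pi else 0))) {0..pi}"
    by (intro has_integral_sum finite_lessThan has_integral_mult_right has_integral_of_real
        has_integral_cos_diff)
  also have "(\<Sum>k<n. \<Sum>l<n. a k * cnj (a l) * of_real (if k = l then 2 * pi else 0)) =
      (\<Sum>k<n. \<Sum>l<n. if k = l then of_real (2 * pi) * of_real ((cmod (a k))\<^sup>2) else 0)"
    unfolding complex_norm_square by (intro sum.cong refl) auto
  also have "\<dots> = complex_of_real (2 * pi * (\<Sum>k<n. (cmod (a k))\<^sup>2))"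
    by (simp add: sum.delta sum_distrib_left)
  finally have "((\<lambda>\<theta>. complex_of_real ((cmod (\<Sum>k<n. a k * cis \<theta> ^ k))\<^sup>2 + (cmod (\<Sum>k<n. a k * cis (- \<theta>) ^ k))\<^sup>2))
    has_integral complex_of_real (2 * pi * (\<Sum>k<n. (cmod (a k))\<^sup>2))) {0..pi}"
    unfolding eq .
  from has_integral_Re[OF this] show ?thesis
    by (simp only: Re_complex_of_real)
qed

text \<open>The integral over the diameter is replaced by the one over the semicircle, where the
  integrand is at most \<open>t \<bar>p (t cis \<theta>)\<bar> \<bar>p (t cis (- \<theta>))\<bar>\<close>; AM-GM and Parseval finish the proof.\<close>
lemma Fejer_Riesz_poly:
  fixes c :: "nat \<Rightarrow> complex"
  assumes t: "0 \<le> t"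
  shows "integral {-t..t} (\<lambda>x. (cmod (\<Sum>k<n. c k * of_real x ^ k))\<^sup>2)
    \<le> t * pi * (\<Sum>k<n. t ^ (2 * k) * (cmod (c k))\<^sup>2)"
proof -
  define p where "p = (\<lambda>z. \<Sum>k<n. c k * z ^ k)"
  \<comment> \<open>This is \<open>p z * cnj (p (cnj z))\<close>. On the real axis it agrees with
    the squared modulus of \<open>p\<close>, but it is a polynomial in \<open>z\<close>, hence
    holomorphic, so the path of integration can be changed.\<close>
  define q where "q = (\<lambda>z. \<Sum>k<n. \<Sum>l<n. c k * cnj (c l) * z ^ (k + l))"
  \<comment> \<open>A primitive of \<open>q\<close>. Diameter and arc have the same end points, so
    both integrals are differences of the same two values of \<open>Q\<close>.\<close>
  define Q where "Q = (\<lambda>z. \<Sum>k<n. \<Sum>l<n. c k * cnj (c l) * (z ^ Suc (k + l) / of_nat (Suc (k + l))))"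
  have q: "q z = p z * cnj (p (cnj z))" for z
    unfolding q_def p_def cnj_sum sum_product
    by (intro sum.cong refl) (simp add: power_add algebra_simps)
  have q_real: "q (of_real x) = of_real ((cmod (p (of_real x)))\<^sup>2)" for x
    unfolding q complex_norm_square by simp
  have Q: "(Q has_field_derivative q z) (at z within S)" for z S
  proof -
    have "((\<lambda>z. z ^ Suc m / of_nat (Suc m)) has_field_derivative z ^ m) (at z within S)" for m
    proof -
      have "((\<lambda>z. z ^ Suc m / of_nat (Suc m)) has_field_derivative
        (of_nat (Suc m) * z ^ m) / of_nat (Suc m)) (at z within S)"
        by (intro DERIV_cdivide) (use DERIV_power_Suc[OF DERIV_ident, of m z S] in simp)
      then show ?thesis
        by (simp only: nonzero_mult_div_cancel_left[OF of_nat_neq_0])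
    qed
    then show ?thesis
      unfolding Q_def q_def by (intro DERIV_sum DERIV_cmult)
  qed
  have "((\<lambda>x. q (of_real x)) has_integral (Q (of_real t) - Q (of_real (- t)))) {-t..t}"
    using t by (intro fundamental_theorem_of_calculus)
      (auto intro!: has_vector_derivative_real_field Q)
  then have "((\<lambda>x. complex_of_real ((cmod (p (of_real x)))\<^sup>2)) has_integral
      (Q (of_real t) - Q (- of_real t))) {-t..t}"
    by (simp only: q_real of_real_minus)
  from has_integral_Re[OF this] have "((\<lambda>x. (cmod (p (of_real x)))\<^sup>2) has_integral Re (Q (of_real t) - Q (- of_real t))) {-t..t}"
    by (simp only: Re_complex_of_real)
  then have I: "integral {-t..t} (\<lambda>x. (cmod (p (of_real x)))\<^sup>2) = Re (Q (of_real t) - Q (- of_real t))"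
    by (rule integral_unique)
  define f where "f = (\<lambda>\<theta>. of_real t * (\<i> * cis \<theta>) * q (of_real t * cis \<theta>))"
  have arc: "(f has_integral (Q (of_real t * cis pi) - Q (of_real t * cis 0))) {0..pi}"
  proof (rule fundamental_theorem_of_calculus)
    fix \<theta>
    have "((\<lambda>\<theta>. of_real t * cis \<theta>) has_vector_derivative of_real t * (\<i> * cis \<theta>)) (at \<theta> within {0..pi})"
    proof -
      have "((\<lambda>z. of_real t * exp (\<i> * z)) has_field_derivative of_real t * (\<i> * exp (\<i> * of_real \<theta>)))
          (at (of_real \<theta>))"
        by (auto intro!: derivative_eq_intros)
      then show ?thesis
        unfolding cis_conv_exp by (rule has_vector_derivative_real_field)
    qed
    from field_vector_diff_chain_within[OF this Q]
    show "((\<lambda>\<theta>. Q (of_real t * cis \<theta>)) has_vector_derivative f \<theta>) (at \<theta> within {0..pi})"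
      by (simp add: o_def f_def mult_ac)
  qed simp
  \<comment> \<open>Rescaling moves the circle of radius \<open>t\<close> to the unit circle; the
    squared moduli of the new coefficients carry the weight \<open>t ^ (2 * k)\<close>.\<close>
  define a where "a = (\<lambda>k. c k * of_real t ^ k)"
  define g where "g = (\<lambda>\<theta>. (cmod (\<Sum>k<n. a k * cis \<theta> ^ k))\<^sup>2 + (cmod (\<Sum>k<n. a k * cis (- \<theta>) ^ k))\<^sup>2)"
  have g: "((\<lambda>\<theta>. t / 2 * g \<theta>) has_integral (t / 2 * (2 * pi * (\<Sum>k<n. (cmod (a k))\<^sup>2)))) {0..pi}"
    unfolding g_def by (intro has_integral_mult_right has_integral_Parseval_semicircles)
  have fg: "norm (f \<theta>) \<le> t / 2 * g \<theta>" for \<theta>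
  proof -
    have p_cis: "p (of_real t * cis \<phi>) = (\<Sum>k<n. a k * cis \<phi> ^ k)" for \<phi>
      by (simp add: p_def a_def power_mult_distrib mult_ac)
    have "norm (f \<theta>) = t * (cmod (p (of_real t * cis \<theta>)) * cmod (p (of_real t * cis (- \<theta>))))"
      using t by (simp add: f_def q norm_mult cis_cnj)
    also have "\<dots> \<le> t * (g \<theta> / 2)"
      unfolding g_def p_cis[symmetric] using t sum_squares_bound[where ?'a = real]
      by (intro mult_left_mono) (simp_all add: field_simps, metis mult.assoc mult.commute)
    finally show ?thesis by simp
  qed
  have "Re (Q (of_real t) - Q (- of_real t)) \<le> cmod (Q (of_real t) - Q (- of_real t))"
    by (rule complex_Re_le_cmod)
  \<comment> \<open>The arc runs from t to -t, against the diameter; under the modulus the sign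
    disappears.\<close>
  also have "\<dots> = norm (integral {0..pi} f)"
    using integral_unique[OF arc] by (simp add: norm_minus_commute)
  also have "\<dots> \<le> integral {0..pi} (\<lambda>\<theta>. t / 2 * g \<theta>)"
    using fg by (intro integral_norm_bound_integral has_integral_integrable[OF arc] has_integral_integrable[OF g])
  also have "\<dots> = t * pi * (\<Sum>k<n. (cmod (a k))\<^sup>2)"
    using integral_unique[OF g] by simp
  also have "(\<Sum>k<n. (cmod (a k))\<^sup>2) = (\<Sum>k<n. t ^ (2 * k) * (cmod (c k))\<^sup>2)"
    using t by (intro sum.cong refl)
      (simp add: a_def norm_mult norm_power power_mult_distrib power_mult[symmetric] mult_ac)
  finally show ?thesis
    using I by (simp add: p_def)
qed

section \<open>The operator defined by power series\<close>

text \<open>One estimate of a nonnegative integral yields both membership and the norm bound. This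
  is the form in which the polynomial bound and Fatou's lemma deliver their results.\<close>

lemma L2_vectorsI:
  assumes f: "f \<in> borel_measurable M" and r: "0 \<le> r"
    and le: "(\<integral>\<^sup>+x. ennreal ((cmod (f x))\<^sup>2) \<partial>M) \<le> ennreal (r\<^sup>2)"
  shows "f \<in> vectors (L2 M)" "ip_norm (L2 M) f \<le> r"
proof -
  have int: "integrable M (\<lambda>x. (cmod (f x))\<^sup>2)"
    using f le by (intro integrableI_nonneg) (auto simp: top_unique less_top[symmetric])
  then show "f \<in> vectors (L2 M)"
    using f by (simp add: L2_def)
  have "ip (L2 M) f f = (LINT x|M. complex_of_real ((cmod (f x))\<^sup>2))"
    unfolding complex_norm_square by (simp add: L2_def mult.commute)
  then have "Re (ip (L2 M) f f) = (LINT x|M. (cmod (f x))\<^sup>2)"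
    using integral_complex_of_real[of M "\<lambda>x. (cmod (f x))\<^sup>2"] by (simp del: of_real_power)
  moreover have "ennreal (LINT x|M. (cmod (f x))\<^sup>2) \<le> ennreal (r\<^sup>2)"
    using nn_integral_eq_integral[OF int] le by simp
  ultimately show "ip_norm (L2 M) f \<le> r"
    using r by (simp add: ip_norm_def real_le_lsqrt)
qed

lemma ip_norm_ell2_sq:
  assumes "\<And>k. 0 \<le> w k" and c: "c \<in> vectors (ell2 w)"
  shows "(ip_norm (ell2 w) c)\<^sup>2 = (\<Sum>k. w k * (cmod (c k))\<^sup>2)"
proof -
  interpret semi_ip_space "ell2 w"
    by (rule semi_ip_space_ell2) fact
  have "(\<lambda>k. w k * (cmod (c k))\<^sup>2) sums (\<Sum>k. w k * (cmod (c k))\<^sup>2)"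
    using c by (intro summable_sums) (simp add: ell2_def)
  then have "(\<lambda>k. complex_of_real (w k * (cmod (c k))\<^sup>2)) sums of_real (\<Sum>k. w k * (cmod (c k))\<^sup>2)"
    by (rule sums_of_real)
  then have "(\<lambda>k. of_real (w k) * cnj (c k) * c k) sums of_real (\<Sum>k. w k * (cmod (c k))\<^sup>2)"
    unfolding of_real_mult complex_norm_square by (simp add: mult_ac)
  then show ?thesis
    using c by (simp add: ip_norm_sq) (simp add: ell2_def sums_iff)
qed

text \<open>Trades the exact support for any initial segment containing it, so that estimates for
  sums below \<open>n\<close> apply and two sequences can share one segment.\<close>

lemma F_finite_iff:
  "(c, p) \<in> F_finite \<longleftrightarrow> (\<exists>n. (\<forall>k\<ge>n. c k = 0) \<and> p = (\<lambda>x. \<Sum>k<n. c k * of_real x ^ k))"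
proof
  assume "(c, p) \<in> F_finite"
  then have fin: "finite {k. c k \<noteq> 0}" and p: "p = (\<lambda>x. \<Sum>k | c k \<noteq> 0. c k * of_real x ^ k)"
    by (auto simp: F_finite_def)
  obtain n where n: "{k. c k \<noteq> 0} \<subseteq> {..<n}"
    using fin by (metis finite_nat_iff_bounded)
  then have "\<forall>k\<ge>n. c k = 0" by force
  moreover have "p = (\<lambda>x. \<Sum>k<n. c k * of_real x ^ k)"
    unfolding p using n by (intro ext sum.mono_neutral_left) auto
  ultimately show "\<exists>n. (\<forall>k\<ge>n. c k = 0) \<and> p = (\<lambda>x. \<Sum>k<n. c k * of_real x ^ k)"
    by blast
next
  assume "\<exists>n. (\<forall>k\<ge>n. c k = 0) \<and> p = (\<lambda>x. \<Sum>k<n. c k * of_real x ^ k)"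
  then obtain n where n: "\<forall>k\<ge>n. c k = 0" and p: "p = (\<lambda>x. \<Sum>k<n. c k * of_real x ^ k)"
    by blast
  have sub: "{k. c k \<noteq> 0} \<subseteq> {..<n}"
    using n not_less by auto
  have "p = (\<lambda>x. \<Sum>k | c k \<noteq> 0. c k * of_real x ^ k)"
    unfolding p using sub by (intro ext sum.mono_neutral_right) auto
  moreover have "finite {k. c k \<noteq> 0}"
    using sub by (rule finite_subset) simp
  ultimately show "(c, p) \<in> F_finite"
    by (auto simp: F_finite_def)
qed

text \<open>Collects what the operator theory takes from \<mu>. A bound on nonnegative integrals
  presupposes no integrability, and \<open>AE_summable\<close> supplies the function that becomes
  the value of F at a general \<open>c\<close>.\<close>

locale bounded_polynomial_map =
  fixes w :: "nat \<Rightarrow> real" and \<mu> :: "real measure" and K :: real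
  assumes sets_eq: "sets \<mu> = sets borel"
    and w_pos: "\<And>k. 0 < w k"
    and K_nonneg: "0 \<le> K"
    and poly_bound: "\<And>n c. (\<integral>\<^sup>+x. ennreal ((cmod (\<Sum>k<n. c k * of_real x ^ k))\<^sup>2) \<partial>\<mu>)
          \<le> ennreal (K\<^sup>2 * (\<Sum>k<n. w k * (cmod (c k))\<^sup>2))"
    and AE_summable: "\<And>c. c \<in> vectors (ell2 w) \<Longrightarrow> AE x in \<mu>. summable (\<lambda>k. c k * of_real x ^ k)"
begin

sublocale semi_ip_space_pair "ell2 w" "L2 \<mu>"
  by (intro semi_ip_space_pair.intro semi_ip_space_L2 semi_ip_space_ell2 less_imp_le w_pos)

lemmas ell2_norm_sq = ip_norm_ell2_sq[OF less_imp_le[OF w_pos]]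

lemma poly_measurable: "(\<lambda>x. \<Sum>k<n. c k * of_real x ^ k :: complex) \<in> borel_measurable \<mu>"
  unfolding measurable_cong_sets[OF sets_eq refl] by measurable

lemma finite_support_ell2:
  assumes "\<forall>k\<ge>n. c k = 0"
  shows "c \<in> vectors (ell2 w)" "(ip_norm (ell2 w) c)\<^sup>2 = (\<Sum>k<n. w k * (cmod (c k))\<^sup>2)"
proof -
  have *: "w k * (cmod (c k))\<^sup>2 = 0" if "k \<notin> {..<n}" for k
    using assms that by simp
  show c: "c \<in> vectors (ell2 w)"
    unfolding ell2_def using summable_finite[of "{..<n}", OF _ *] by simp
  show "(ip_norm (ell2 w) c)\<^sup>2 = (\<Sum>k<n. w k * (cmod (c k))\<^sup>2)"
    unfolding ell2_norm_sq[OF c] by (rule suminf_finite[of "{..<n}", OF _ *]) simp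
qed

lemma poly_L2: "(\<lambda>x. \<Sum>k<n. c k * of_real x ^ k) \<in> vectors (L2 \<mu>)"
proof (rule L2_vectorsI[OF poly_measurable])
  have s: "0 \<le> (\<Sum>k<n. w k * (cmod (c k))\<^sup>2)"
    by (intro sum_nonneg mult_nonneg_nonneg less_imp_le[OF w_pos]) simp
  then show "0 \<le> sqrt (K\<^sup>2 * (\<Sum>k<n. w k * (cmod (c k))\<^sup>2))"
    by simp
  show "(\<integral>\<^sup>+x. ennreal ((cmod (\<Sum>k<n. c k * of_real x ^ k))\<^sup>2) \<partial>\<mu>)
      \<le> ennreal ((sqrt (K\<^sup>2 * (\<Sum>k<n. w k * (cmod (c k))\<^sup>2)))\<^sup>2)"
    using poly_bound[where n = n and c = c] s by simp
qed

lemma monomial_L2: "(\<lambda>x. of_real x ^ n) \<in> vectors (L2 \<mu>)"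
proof -
  have "(\<Sum>k<Suc n. (if k = n then 1 else 0) * of_real x ^ k) = (of_real x ^ n :: complex)" for x :: real
    by simp
  then show ?thesis
    using poly_L2[where c = "\<lambda>k. if k = n then 1 else 0" and n = "Suc n"] by presburger
qed

lemma F_finite_bound:
  assumes "(c, p) \<in> F_finite"
  shows "c \<in> vectors (ell2 w)" "p \<in> vectors (L2 \<mu>)" "ip_norm (L2 \<mu>) p \<le> K * ip_norm (ell2 w) c"
proof -
  obtain n where n: "\<forall>k\<ge>n. c k = 0" and p: "p = (\<lambda>x. \<Sum>k<n. c k * of_real x ^ k)"
    using assms unfolding F_finite_iff by blast
  show c: "c \<in> vectors (ell2 w)"
    using n by (rule finite_support_ell2)
  show "p \<in> vectors (L2 \<mu>)"
    unfolding p by (rule poly_L2)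
  show "ip_norm (L2 \<mu>) p \<le> K * ip_norm (ell2 w) c"
    unfolding p
  proof (rule L2_vectorsI[OF poly_measurable])
    show "0 \<le> K * ip_norm (ell2 w) c"
      using c K_nonneg X.ip_norm_nonneg by simp
    show "(\<integral>\<^sup>+x. ennreal ((cmod (\<Sum>k<n. c k * of_real x ^ k))\<^sup>2) \<partial>\<mu>)
      \<le> ennreal ((K * ip_norm (ell2 w) c)\<^sup>2)"
      unfolding power_mult_distrib finite_support_ell2(2)[OF n] by (rule poly_bound)
  qed
qed

lemma F_finite_sub: "F_finite \<subseteq> vectors (ell2 w) \<times> vectors (L2 \<mu>)"
  using F_finite_bound(1,2) by auto

lemma F_finite_zero: "((\<lambda>_. 0), (\<lambda>_. 0)) \<in> F_finite"
  unfolding F_finite_iff by (intro exI[of _ 0]) simp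

lemma F_finite_lin:
  assumes "(x, y) \<in> F_finite" "(x', y') \<in> F_finite"
  shows "((\<lambda>i. a * x i + b * x' i), (\<lambda>j. a * y j + b * y' j)) \<in> F_finite"
proof -
  obtain n n' where n: "\<forall>k\<ge>n. x k = 0" "y = (\<lambda>t. \<Sum>k<n. x k * of_real t ^ k)"
    and n': "\<forall>k\<ge>n'. x' k = 0" "y' = (\<lambda>t. \<Sum>k<n'. x' k * of_real t ^ k)"
    using assms unfolding F_finite_iff by blast
  define N where "N = max n n'"
  have extend: "(\<lambda>t::real. \<Sum>k<m. z k * of_real t ^ k) = (\<lambda>t. \<Sum>k<N. z k * of_real t ^ k)"
    if "\<forall>k\<ge>m. z k = 0" "m \<le> N" for m and z :: "nat \<Rightarrow> complex"
    using that by (intro ext sum.mono_neutral_left) auto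
  have "y = (\<lambda>t. \<Sum>k<N. x k * of_real t ^ k)" "y' = (\<lambda>t. \<Sum>k<N. x' k * of_real t ^ k)"
    unfolding n(2) n'(2) using extend[of n x] extend[of n' x'] n(1) n'(1) by (simp_all add: N_def)
  then have "(\<lambda>j. a * y j + b * y' j) = (\<lambda>t. \<Sum>k<N. (a * x k + b * x' k) * of_real t ^ k)"
    by (simp add: sum_distrib_left sum.distrib algebra_simps)
  moreover have "\<forall>k\<ge>N. a * x k + b * x' k = 0"
    using n(1) n'(1) by (simp add: N_def)
  ultimately show ?thesis
    unfolding F_finite_iff by blast
qed

lemma linear_operator_F: "linear_operator (ell2 w) (L2 \<mu>) (F_op w \<mu>)"
  unfolding F_op_def
  by (rule linear_operator_closure[OF F_finite_sub F_finite_zero F_finite_lin F_finite_bound(3)])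

lemma F_bound: "(c, p) \<in> F_op w \<mu> \<Longrightarrow> ip_norm (L2 \<mu>) p \<le> K * ip_norm (ell2 w) c"
  unfolding F_op_def by (rule operator_closure_bound[OF F_finite_sub F_finite_bound(3)])

lemma F_sub: "F_op w \<mu> \<subseteq> vectors (ell2 w) \<times> vectors (L2 \<mu>)"
  using linear_operator_F by (simp add: linear_operator_def)

text \<open>By Fatou's lemma, applied to the partial sums.\<close>
lemma power_series_bound:
  assumes c: "c \<in> vectors (ell2 w)" and f: "f \<in> borel_measurable \<mu>"
    and sums: "AE x in \<mu>. (\<lambda>k. c k * of_real x ^ k) sums f x"
  shows "f \<in> vectors (L2 \<mu>)" "ip_norm (L2 \<mu>) f \<le> K * ip_norm (ell2 w) c"
proof -
  define u where "u = (\<lambda>n x. ennreal ((cmod (\<Sum>k<n. c k * of_real x ^ k))\<^sup>2))"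
  have u_meas: "u n \<in> borel_measurable \<mu>" for n
    unfolding u_def using poly_measurable[of c n] by measurable
  have "AE x in \<mu>. ennreal ((cmod (f x))\<^sup>2) = liminf (\<lambda>n. u n x)"
    using sums
  proof eventually_elim
    case (elim x)
    then have "(\<lambda>n. u n x) \<longlonglongrightarrow> ennreal ((cmod (f x))\<^sup>2)"
      unfolding u_def sums_def by (intro tendsto_ennrealI tendsto_intros)
    then show ?case
      by (simp add: lim_imp_Liminf)
  qed
  then have "(\<integral>\<^sup>+x. ennreal ((cmod (f x))\<^sup>2) \<partial>\<mu>) = (\<integral>\<^sup>+x. liminf (\<lambda>n. u n x) \<partial>\<mu>)"
    by (rule nn_integral_cong_AE)
  also have "\<dots> \<le> liminf (\<lambda>n. integral\<^sup>N \<mu> (u n))"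
    by (rule nn_integral_liminf[OF u_meas])
  also have "\<dots> \<le> liminf (\<lambda>n::nat. ennreal ((K * ip_norm (ell2 w) c)\<^sup>2))"
  proof (intro Liminf_mono always_eventually allI)
    fix n
    have "(\<Sum>k<n. w k * (cmod (c k))\<^sup>2) \<le> (ip_norm (ell2 w) c)\<^sup>2"
      unfolding ell2_norm_sq[OF c] using c
      by (intro sum_le_suminf) (auto simp: ell2_def less_imp_le[OF w_pos])
    then have "K\<^sup>2 * (\<Sum>k<n. w k * (cmod (c k))\<^sup>2) \<le> (K * ip_norm (ell2 w) c)\<^sup>2"
      by (simp add: power_mult_distrib mult_left_mono)
    then show "integral\<^sup>N \<mu> (u n) \<le> ennreal ((K * ip_norm (ell2 w) c)\<^sup>2)"
      unfolding u_def using poly_bound[where n = n and c = c] ennreal_leI order_trans by blast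
  qed
  also have "\<dots> = ennreal ((K * ip_norm (ell2 w) c)\<^sup>2)"
    by (simp add: Liminf_const)
  finally have le: "(\<integral>\<^sup>+x. ennreal ((cmod (f x))\<^sup>2) \<partial>\<mu>) \<le> ennreal ((K * ip_norm (ell2 w) c)\<^sup>2)" .
  have "0 \<le> K * ip_norm (ell2 w) c"
    using c K_nonneg X.ip_norm_nonneg by simp
  from L2_vectorsI[OF f this le]
  show "f \<in> vectors (L2 \<mu>)" "ip_norm (L2 \<mu>) f \<le> K * ip_norm (ell2 w) c" .
qed

text \<open>The squared distance is the tail of a convergent series.\<close>

lemma truncation_tendsto:
  assumes c: "c \<in> vectors (ell2 w)"
  shows "(\<lambda>n. ip_dist (ell2 w) (\<lambda>k. if k < n then c k else 0) c) \<longlonglongrightarrow> 0"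
proof -
  let ?a = "\<lambda>k. w k * (cmod (c k))\<^sup>2"
  have a: "summable ?a"
    using c by (simp add: ell2_def)
  have eq: "(ip_dist (ell2 w) (\<lambda>k. if k < n then c k else 0) c)\<^sup>2 = suminf ?a - sum ?a {..<n}" for n
  proof -
    let ?d = "\<lambda>k. if k < n then c k else 0"
    have d: "?d \<in> vectors (ell2 w)"
      by (rule finite_support_ell2(1)[of n]) simp
    have "(\<lambda>k. if k \<in> {..<n} then ?a k else 0) sums sum ?a {..<n}"
      by (rule sums_If_finite_set) simp
    from sums_diff[OF summable_sums[OF a] this]
    have "(\<lambda>k. w k * (cmod (?d k - c k))\<^sup>2) sums (suminf ?a - sum ?a {..<n})"
      by (rule sums_cong[THEN iffD1, rotated]) auto
    then show ?thesis
      using ell2_norm_sq[OF X.diff_vec[OF d c]] by (simp add: ip_dist_def sums_iff)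
  qed
  have "(\<lambda>n. suminf ?a - sum ?a {..<n}) \<longlonglongrightarrow> suminf ?a - suminf ?a"
    by (intro tendsto_intros summable_LIMSEQ a)
  then have "(\<lambda>n. (ip_dist (ell2 w) (\<lambda>k. if k < n then c k else 0) c)\<^sup>2) \<longlonglongrightarrow> 0"
    by (simp add: eq)
  then show ?thesis
    by (simp add: power_tendsto_0_iff)
qed

lemma Domain_F: "Domain (F_op w \<mu>) = vectors (ell2 w)"
proof
  show "Domain (F_op w \<mu>) \<subseteq> vectors (ell2 w)"
    using F_sub by auto
next
  show "vectors (ell2 w) \<subseteq> Domain (F_op w \<mu>)"
  proof
    fix c assume c: "c \<in> vectors (ell2 w)"
    \<comment> \<open>Where the series diverges the value is unspecified, which by
      \<open>AE_summable\<close> concerns only a null set.\<close>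
    define f where "f = (\<lambda>x::real. \<Sum>k. c k * of_real x ^ k)"
    have f_meas: "f \<in> borel_measurable \<mu>"
      unfolding f_def measurable_cong_sets[OF sets_eq refl] by measurable
    have sums: "AE x in \<mu>. (\<lambda>k. c k * of_real x ^ k) sums f x"
      using AE_summable[OF c] unfolding f_def by eventually_elim (rule summable_sums)
    have f: "f \<in> vectors (L2 \<mu>)"
      by (rule power_series_bound[OF c f_meas sums])
    define d where "d = (\<lambda>n k. if k < n then c k else 0)"
    define p where "p = (\<lambda>n (x::real). \<Sum>k<n. d n k * of_real x ^ k)"
    have d: "d n \<in> vectors (ell2 w)" for n
      by (rule finite_support_ell2(1)[of n]) (simp add: d_def)
    have lim: "(\<lambda>n. K * ip_dist (ell2 w) (d n) c) \<longlonglongrightarrow> 0"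
      using tendsto_mult_left[OF truncation_tendsto[OF c], of K] by (simp add: d_def)
    have le: "ip_dist (L2 \<mu>) (p n) f \<le> K * ip_dist (ell2 w) (d n) c" for n
      unfolding ip_dist_def
    \<comment> \<open>The error \<open>p n - f\<close> is itself the sum of a power series, with
      coefficients \<open>d n - c\<close>, so the bound for power series controls the rate of
      approximation.\<close>
    proof (rule power_series_bound[OF X.diff_vec[OF d c]])
      show "(\<lambda>x. p n x - f x) \<in> borel_measurable \<mu>"
        unfolding p_def by (intro borel_measurable_diff poly_measurable f_meas)
      show "AE x in \<mu>. (\<lambda>k. (d n k - c k) * of_real x ^ k) sums (p n x - f x)"
        using sums
      proof eventually_elim
        case (elim x)
        have "(\<lambda>k. d n k * of_real x ^ k) sums p n x"
          unfolding p_def by (rule sums_finite) (simp_all add: d_def)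
        from sums_diff[OF this elim] show ?case
          by (simp add: left_diff_distrib)
      qed
    qed
    have "(\<lambda>n. ip_dist (L2 \<mu>) (p n) f) \<longlonglongrightarrow> 0"
    proof (rule Lim_null_comparison[OF _ lim], intro always_eventually allI)
      fix n
      have "0 \<le> ip_dist (L2 \<mu>) (p n) f"
        unfolding ip_dist_def p_def by (intro Y.ip_norm_nonneg Y.diff_vec poly_L2 f)
      then show "norm (ip_dist (L2 \<mu>) (p n) f) \<le> K * ip_dist (ell2 w) (d n) c"
        using le by simp
    qed
    moreover have "(d n, p n) \<in> F_finite" for n
      unfolding F_finite_iff p_def by (intro exI[of _ n]) (simp add: d_def)
    moreover have "(\<lambda>n. ip_dist (ell2 w) (d n) c) \<longlonglongrightarrow> 0"
      unfolding d_def by (rule truncation_tendsto[OF c])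
    ultimately have "(c, f) \<in> F_op w \<mu>"
      unfolding F_op_def operator_closure_def using c f by blast
    then show "c \<in> Domain (F_op w \<mu>)" by blast
  qed
qed

lemma ip_poly_left:
  assumes g: "g \<in> vectors (L2 \<mu>)"
  shows "ip (L2 \<mu>) (\<lambda>x. \<Sum>k<n. c k * of_real x ^ k) g =
    (\<Sum>k<n. cnj (c k) * ip (L2 \<mu>) (\<lambda>x. of_real x ^ k) g)"
proof (induction n)
  case 0
  show ?case by (simp add: L2_def)
next
  case (Suc n)
  have "ip (L2 \<mu>) (\<lambda>x. 1 * (\<Sum>k<n. c k * of_real x ^ k) + c n * of_real x ^ n) g =
     cnj 1 * ip (L2 \<mu>) (\<lambda>x. \<Sum>k<n. c k * of_real x ^ k) g
     + cnj (c n) * ip (L2 \<mu>) (\<lambda>x. of_real x ^ n) g"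
    by (rule Y.ip_lin_left[OF g poly_L2 monomial_L2])
  then show ?case using Suc by simp
qed

text \<open>The adjoint relation on monomials forces the candidate \<open>c\<close>: moments divided
  by weights. What has to be shown is that it is square-summable with the weights, and this follows
  by duality from the bound on polynomials.\<close>

lemma Domain_F_adj: "Domain (F_adj w \<mu>) = vectors (L2 \<mu>)"
proof
  show "Domain (F_adj w \<mu>) \<subseteq> vectors (L2 \<mu>)"
    by (auto simp: F_adj_def adjoint_operator_def)
next
  show "vectors (L2 \<mu>) \<subseteq> Domain (F_adj w \<mu>)"
  proof
    fix g assume g: "g \<in> vectors (L2 \<mu>)"
    define c where "c = (\<lambda>k. ip (L2 \<mu>) (\<lambda>x. of_real x ^ k) g / of_real (w k))"
    have m: "ip (L2 \<mu>) (\<lambda>x. of_real x ^ k) g = of_real (w k) * c k" for k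
      using w_pos[of k] by (simp add: c_def)
    define B where "B = K * ip_norm (L2 \<mu>) g"
    have S: "(\<Sum>k<n. w k * (cmod (c k))\<^sup>2) \<le> B\<^sup>2" for n
    proof -
      \<comment> \<open>Testing with the truncation of \<open>c\<close> itself turns the pairing
        with \<open>g\<close> into the partial sum, which is \<open>s\<close> squared. The bound on
        F gives that \<open>s\<close> squared is at most \<open>s * B\<close>, so \<open>s\<close>
        is at most \<open>B\<close>, uniformly in \<open>n\<close>.\<close>
      define u where "u = (\<lambda>k. if k < n then c k else 0)"
      define v where "v = (\<lambda>x::real. \<Sum>k<n. u k * of_real x ^ k)"
      have u: "\<forall>k\<ge>n. u k = 0" and uv: "(u, v) \<in> F_finite"
        unfolding F_finite_iff v_def by (auto intro!: exI[of _ n] simp: u_def)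
      define s where "s = ip_norm (ell2 w) u"
      have s: "0 \<le> s"
        unfolding s_def by (intro X.ip_norm_nonneg F_finite_bound(1)[OF uv])
      have s2: "s\<^sup>2 = (\<Sum>k<n. w k * (cmod (c k))\<^sup>2)"
        unfolding s_def finite_support_ell2(2)[OF u] by (simp add: u_def)
      have "ip (L2 \<mu>) v g = (\<Sum>k<n. of_real (w k * (cmod (c k))\<^sup>2))"
        unfolding v_def ip_poly_left[OF g] m of_real_mult complex_norm_square
        by (simp add: u_def mult_ac)
      then have "ip (L2 \<mu>) v g = of_real (s\<^sup>2)"
        unfolding s2 by simp
      then have "s\<^sup>2 \<le> ip_norm (L2 \<mu>) v * ip_norm (L2 \<mu>) g"
        using Y.Cauchy_Schwarz[OF F_finite_bound(2)[OF uv] g] by (simp add: norm_power)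
      also have "\<dots> \<le> (K * s) * ip_norm (L2 \<mu>) g"
        unfolding s_def by (intro mult_right_mono F_finite_bound(3) uv Y.ip_norm_nonneg g)
      finally have "s * s \<le> s * B"
        by (simp add: B_def power2_eq_square mult_ac)
      moreover have "0 \<le> B"
        unfolding B_def using K_nonneg Y.ip_norm_nonneg[OF g] by simp
      ultimately have "s \<le> B"
        using s by (cases "s = 0") auto
      then show ?thesis
        unfolding s2[symmetric] using s by (intro power_mono)
    qed
    have c: "c \<in> vectors (ell2 w)"
    proof -
      have "summable (\<lambda>k. w k * (cmod (c k))\<^sup>2)"
        by (rule summableI_nonneg_bounded[OF _ S]) (simp add: less_imp_le[OF w_pos])
      then show ?thesis by (simp add: ell2_def)
    qed
    have "ip (L2 \<mu>) v g = ip (ell2 w) u c" if uv: "(u, v) \<in> F_finite" for u v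
    proof -
      obtain n where n: "\<forall>k\<ge>n. u k = 0" and v: "v = (\<lambda>x. \<Sum>k<n. u k * of_real x ^ k)"
        using uv unfolding F_finite_iff by blast
      have "ip (ell2 w) u c = (\<Sum>k<n. of_real (w k) * cnj (u k) * c k)"
        unfolding ell2_def using n by (simp, intro suminf_finite) auto
      then show ?thesis
        unfolding v ip_poly_left[OF g] m by (simp add: mult_ac)
    qed
    then have "(g, c) \<in> adjoint_operator (ell2 w) (L2 \<mu>) F_finite"
      using g c by (auto simp: adjoint_operator_def)
    then have "(g, c) \<in> F_adj w \<mu>"
      unfolding F_adj_def F_op_def by (rule adjoint_operator_closure[OF F_finite_sub])
    then show "g \<in> Domain (F_adj w \<mu>)" by blast
  qed
qed

lemma F_adj_bound: "(g, c) \<in> F_adj w \<mu> \<Longrightarrow> ip_norm (ell2 w) c \<le> K * ip_norm (L2 \<mu>) g"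
  unfolding F_adj_def by (rule adjoint_operator_bound[OF F_sub Domain_F F_bound K_nonneg])

lemma linear_operator_F_adj: "linear_operator (L2 \<mu>) (ell2 w) (F_adj w \<mu>)"
  unfolding F_adj_def by (rule linear_operator_adjoint[OF F_sub Domain_F F_bound K_nonneg])

lemma bounded_operator_F: "bounded_operator (ell2 w) (L2 \<mu>) (F_op w \<mu>)"
  unfolding bounded_operator_def using linear_operator_F Domain_F F_bound by auto

lemma bounded_operator_F_adj: "bounded_operator (L2 \<mu>) (ell2 w) (F_adj w \<mu>)"
  unfolding bounded_operator_def using linear_operator_F_adj Domain_F_adj F_adj_bound by auto

lemmas F_adj_comp_F = bounded_operator_comp[OF X.semi_ip_space_axioms linear_operator_F Domain_F F_bound
    linear_operator_F_adj Domain_F_adj F_adj_bound K_nonneg K_nonneg]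

lemmas F_comp_F_adj = semi_ip_space_pair.bounded_operator_comp[OF
    semi_ip_space_pair_commute[OF semi_ip_space_pair_axioms] Y.semi_ip_space_axioms
    linear_operator_F_adj Domain_F_adj F_adj_bound linear_operator_F Domain_F F_bound K_nonneg K_nonneg]

end

section \<open>From the density and its support to the polynomial bound and convergence\<close>

text \<open>The complement of the support is a union of open null sets; second countability reduces
  it to a countable union.\<close>

lemma AE_in_measure_support:
  fixes M :: "'a::second_countable_topology measure"
  assumes sets: "sets M = sets borel"
  shows "AE x in M. x \<in> measure_support M"
proof -
  define F where "F = {U. open U \<and> emeasure M U = 0}"
  obtain F' where F': "F' \<subseteq> F" "countable F'" "\<Union>F' = \<Union>F"
    using Lindelof[of F] by (auto simp: F_def)
  have "(\<Union>U\<in>F'. U) \<in> null_sets M"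
  proof (rule null_sets_UN'[OF F'(2)])
    fix U assume "U \<in> F'"
    then show "U \<in> null_sets M"
      using F'(1) sets by (auto simp: F_def null_sets_def)
  qed
  then have "AE x in M. x \<notin> \<Union>F"
    using F'(3) AE_not_in[of "\<Union>F'" M] by simp
  then show ?thesis
    by eventually_elim (auto simp: F_def measure_support_def zero_less_iff_neq_zero)
qed

text \<open>The terms of the weighted series tend to 0, so eventually |c_k| is at most t^(-k), and a
  geometric series of ratio |x| / t < 1 dominates.\<close>

lemma summable_power_series_ell2:
  fixes c :: "nat \<Rightarrow> complex" and x :: real
  assumes t: "0 < t" and x: "\<bar>x\<bar> < t" and c: "summable (\<lambda>k. t ^ (2 * k) * (cmod (c k))\<^sup>2)"
  shows "summable (\<lambda>k. c k * of_real x ^ k)"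
proof (rule summable_comparison_test_ev)
  show "summable (\<lambda>k. (\<bar>x\<bar> / t) ^ k)"
    using t x by (intro summable_geometric) simp
  have "\<forall>\<^sub>F k in sequentially. t ^ (2 * k) * (cmod (c k))\<^sup>2 < 1"
    using summable_LIMSEQ_zero[OF c] by (rule order_tendstoD) simp
  then show "\<forall>\<^sub>F k in sequentially. norm (c k * of_real x ^ k) \<le> (\<bar>x\<bar> / t) ^ k"
  proof eventually_elim
    case (elim k)
    then have "(t ^ k * cmod (c k))\<^sup>2 \<le> 1\<^sup>2"
      by (simp add: power_mult_distrib power_mult[symmetric] mult.commute)
    then have "t ^ k * cmod (c k) \<le> 1"
      by (rule power2_le_imp_le) simp
    then have "cmod (c k) \<le> 1 / t ^ k"
      using t by (simp add: field_simps)
    then have "cmod (c k) * \<bar>x\<bar> ^ k \<le> 1 / t ^ k * \<bar>x\<bar> ^ k"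
      by (rule mult_right_mono) simp
    then show ?case
      by (simp add: norm_mult norm_power power_divide)
  qed
qed

text \<open>Support and essential bound combine into one domination: \<open>B\<close> times
  \<open>g\<close> is at most \<open>M\<close> times \<open>g\<close> cut off to the interval,
  Lebesgue almost everywhere.\<close>

lemma nn_integral_density_le:
  fixes B g :: "real \<Rightarrow> real"
  assumes B: "B \<in> borel_measurable borel" and g: "continuous_on UNIV g" "\<And>x. 0 \<le> g x"
    and M: "AE x in lborel. B x \<le> M" "0 \<le> M"
    and supp: "AE x in density lborel (\<lambda>x. ennreal (B x)). x \<in> {a..b}"
  shows "(\<integral>\<^sup>+x. ennreal (g x) \<partial>density lborel (\<lambda>x. ennreal (B x))) \<le> ennreal (M * integral {a..b} g)"
proof -
  have g_meas [measurable]: "g \<in> borel_measurable borel"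
    using g(1) by (rule borel_measurable_continuous_onI)
  note [measurable] = B
  define h where "h = (\<lambda>x. if x \<in> {a..b} then g x else 0)"
  have h_meas [measurable]: "h \<in> borel_measurable borel"
    unfolding h_def by measurable
  have "g integrable_on {a..b}"
    by (rule integrable_continuous_real[OF continuous_on_subset[OF g(1)]]) simp
  then have "(h has_integral integral {a..b} g) UNIV"
    unfolding h_def has_integral_restrict_UNIV by (rule integrable_integral)
  then have h: "(\<integral>\<^sup>+x. ennreal (h x) \<partial>lborel) = ennreal (integral {a..b} g)"
    by (intro nn_integral_has_integral_lborel h_meas) (auto simp: h_def g)
  \<comment> \<open>A statement almost everywhere for the density says something about Lebesgue
    almost every point only where \<open>B\<close> is positive; elsewhere the left side of the
    domination is 0.\<close>
  have "AE x in lborel. 0 < ennreal (B x) \<longrightarrow> x \<in> {a..b}"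
    using supp by (subst (asm) AE_density) auto
  then have le: "AE x in lborel. ennreal (B x) * ennreal (g x) \<le> ennreal M * ennreal (h x)"
    using M(1)
  proof eventually_elim
    case (elim x)
    show ?case
    proof (cases "0 < B x")
      case True
      then have "h x = g x"
        using elim by (simp add: h_def)
      then show ?thesis
        using elim by (auto intro!: mult_right_mono ennreal_leI)
    qed (simp add: ennreal_neg)
  qed
  have "(\<integral>\<^sup>+x. ennreal (g x) \<partial>density lborel (\<lambda>x. ennreal (B x))) =
      (\<integral>\<^sup>+x. ennreal (B x) * ennreal (g x) \<partial>lborel)"
    by (rule nn_integral_density) measurable
  also have "\<dots> \<le> (\<integral>\<^sup>+x. ennreal M * ennreal (h x) \<partial>lborel)"
    using le by (rule nn_integral_mono_AE)
  also have "\<dots> = ennreal M * ennreal (integral {a..b} g)"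
    unfolding h[symmetric] by (rule nn_integral_cmult) measurable
  also have "\<dots> = ennreal (M * integral {a..b} g)"
    using M(2) by (simp add: ennreal_mult')
  finally show ?thesis .
qed

text \<open>The essential supremum must be a real number before its square root can enter the norm
  bound. Boundedness excludes infinity; nonnegativity on a space of nonzero measure excludes minus
  infinity.\<close>

lemma esssup_real:
  fixes f :: "'a \<Rightarrow> real"
  assumes f: "f \<in> borel_measurable M" "bounded (range f)" "\<And>x. 0 \<le> f x"
    and M: "emeasure M (space M) \<noteq> 0"
  obtains r where "esssup M (\<lambda>x. ereal (f x)) = ereal r" "0 \<le> r" "AE x in M. f x \<le> r"
proof -
  let ?e = "esssup M (\<lambda>x. ereal (f x))"
  obtain b where b: "\<And>x. \<bar>f x\<bar> \<le> b"
    using f(2) by (auto simp: bounded_iff)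
  have "?e \<le> ereal b"
    using f(1) b by (intro esssup_I AE_I2) (auto intro: abs_le_D1)
  moreover have "esssup M (\<lambda>x. 0::ereal) \<le> ?e"
    using f(3) by (intro esssup_mono) auto
  then have "0 \<le> ?e"
    by (simp add: esssup_const[OF M])
  ultimately obtain r where r: "?e = ereal r"
    by (cases ?e) auto
  show ?thesis
  proof
    show "0 \<le> r" using \<open>0 \<le> ?e\<close> r by simp
    show "AE x in M. f x \<le> r"
      using esssup_AE[of "\<lambda>x. ereal (f x)" M] by (simp add: r)
  qed (fact r)
qed

theorem theorem7p3:
  fixes t :: real and B :: "real \<Rightarrow> real" and \<mu> :: "real measure" and w :: "nat \<Rightarrow> real"
  assumes t: "t > 1"
    and B_meas: "B \<in> borel_measurable borel"
    and B_nonneg: "\<And>x. 0 \<le> B x"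
    and B_bounded: "bounded (range B)"
    and mu: "\<mu> = density lborel (\<lambda>x. ennreal (B x))"
    and moments: "\<And>k::nat. integrable \<mu> (\<lambda>x. x ^ k)"
    and supp: "measure_support \<mu> \<subseteq> {-t..t}"
    and w: "\<And>k. w k = t ^ (2 * k)"
  shows "bounded_operator (ell2 w) (L2 \<mu>) (F_op w \<mu>)
    \<and> bounded_operator (L2 \<mu>) (ell2 w) (F_adj w \<mu>)
    \<and> bounded_operator (ell2 w) (ell2 w) (F_op w \<mu> O F_adj w \<mu>)
    \<and> bounded_operator (L2 \<mu>) (L2 \<mu>) (F_adj w \<mu> O F_op w \<mu>)
    \<and> ereal (operator_norm (ell2 w) (ell2 w) (F_op w \<mu> O F_adj w \<mu>))
        \<le> ereal (t * pi) * esssup lborel (\<lambda>x. ereal (B x))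
    \<and> ereal (operator_norm (L2 \<mu>) (L2 \<mu>) (F_adj w \<mu> O F_op w \<mu>))
        \<le> ereal (t * pi) * esssup lborel (\<lambda>x. ereal (B x))"
proof -
  have B_meas': "B \<in> borel_measurable lborel"
    using B_meas by simp
  obtain M where M: "esssup lborel (\<lambda>x. ereal (B x)) = ereal M" "0 \<le> M" "AE x in lborel. B x \<le> M"
    by (rule esssup_real[OF B_meas' B_bounded B_nonneg]) simp
  define K where "K = sqrt (t * pi * M)"
  have K2: "K\<^sup>2 = t * pi * M"
    using t M(2) by (simp add: K_def)
  have sets: "sets \<mu> = sets borel"
    by (simp add: mu)
  have supp_AE: "AE x in \<mu>. x \<in> {-t..t}"
    using AE_in_measure_support[OF sets] by eventually_elim (use supp in blast)
  interpret bounded_polynomial_map w \<mu> K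
  proof
    show "sets \<mu> = sets borel" by (fact sets)
    show "0 < w k" for k using t by (simp add: w)
    show "0 \<le> K" using t M(2) by (simp add: K_def)
  next
    fix n and c :: "nat \<Rightarrow> complex"
    let ?g = "\<lambda>x. (cmod (\<Sum>k<n. c k * of_real x ^ k))\<^sup>2"
    have "(\<integral>\<^sup>+x. ennreal (?g x) \<partial>\<mu>) \<le> ennreal (M * integral {-t..t} ?g)"
      unfolding mu using supp_AE[unfolded mu]
      by (intro nn_integral_density_le B_meas M) (auto intro!: continuous_intros)
    also have "\<dots> \<le> ennreal (M * (t * pi * (\<Sum>k<n. t ^ (2 * k) * (cmod (c k))\<^sup>2)))"
      using t M(2) by (intro ennreal_leI mult_left_mono Fejer_Riesz_poly) auto
    also have "M * (t * pi * (\<Sum>k<n. t ^ (2 * k) * (cmod (c k))\<^sup>2)) = K\<^sup>2 * (\<Sum>k<n. w k * (cmod (c k))\<^sup>2)"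
      by (simp add: K2 w)
    finally show "(\<integral>\<^sup>+x. ennreal (?g x) \<partial>\<mu>) \<le> ennreal (K\<^sup>2 * (\<Sum>k<n. w k * (cmod (c k))\<^sup>2))" .
  next
    fix c :: "nat \<Rightarrow> complex" assume "c \<in> vectors (ell2 w)"
    then have c: "summable (\<lambda>k. t ^ (2 * k) * (cmod (c k))\<^sup>2)"
      by (simp add: ell2_def w)
    \<comment> \<open>The support may contain the end points, where the power series can diverge;
      they are Lebesgue null and therefore null for the density.\<close>
    have "AE x in lborel. x \<noteq> t \<and> x \<noteq> - t"
      using AE_lborel_singleton[of t] AE_lborel_singleton[of "- t"] by eventually_elim simp
    then have "AE x in \<mu>. x \<noteq> t \<and> x \<noteq> - t"
      unfolding mu using B_meas by (subst AE_density) auto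
    with supp_AE show "AE x in \<mu>. summable (\<lambda>k. c k * of_real x ^ k)"
    proof eventually_elim
      case (elim x)
      then show ?case
        using t by (intro summable_power_series_ell2[OF _ _ c]) auto
    qed
  qed
  have KK: "K * K = t * pi * M"
    using K2 by (simp add: power2_eq_square)
  show ?thesis
    using bounded_operator_F bounded_operator_F_adj F_adj_comp_F F_comp_F_adj
    by (simp add: M(1) KK)
qed

end
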